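(* Let $\mathcal E^p=\{(I\times\Omega,\mathcal I\boxtimes\mathcal F,\lambda\boxtimes P),u,e,f,\tilde s\}$ be a private information economy (as defined in the context). (1) Under assumptions A1, A2, A3 (stated in the context), for any ex ante efficient allocation $x^p$, there is an incentive compatible, ex ante efficient allocation $y^p$ that is utility equivalent to $x^p$. (2) Under assumptions A1, A2$'$, A3 (stated in the context), for any ex ante efficient allocation $x^p$, there is an incentive compatible, ex ante efficient allocation $y^p$ that is essentially equivalent to $x^p$.
   Context: Conventions. All probability spaces are countably additive and complete (measurability/integrability with respect to a probability measure is understood relative to its completion). A probability space $(I\times\Omega,\mathcal W,Q)$ extending the usual product $(I\times\Omega,\mathcal I\otimes\mathcal F,\lambda\otimes P)$ is a Fubini extension if for every real-valued $Q$-integrable $h$ on $(I\times\Omega,\mathcal W)$: (1) $h(i,\cdot)$ is $P$-integrable for $\lambda$-almost all $i$ and $h(\cdot,\omega)$ is $\lambda$-integrable for $P$-almost all $\omega$; (2) $i\mapsto\int_\Omega h(i,\cdot)\,dP$ and $\omega\mapsto\int_I h(\cdot,\omega)\,d\lambda$ are integrable and $\int h\,dQ=\int_I\int_\Omega h\,dP\,d\lambda=\int_\Omega\int_I h\,d\lambda\,dP$. It is then denoted $(I\times\Omega,\mathcal I\boxtimes\mathcal F,\lambda\boxtimes P)$. Information structure. $(I,\mathcal I,\lambda)$ is an atomless probability space of agents. $T^0=\{q_1,\dots,q_L\}$ is a finite set of signals with power set $\mathcal T^0$; $\Delta^0$ is the set of probability measures on $T^0$. $T$ is a set of functions $t:I\to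 T^0$ (signal profiles) with a $\sigma$-algebra $\mathcal T$; $t_i=t(i)$, $t_{-i}$ is the restriction of $t$ to $I\setminus\{i\}$, $T_{-i}$ is the set of all such $t_{-i}$. For each $i$, $(T,\mathcal T)$ has the product structure $T=T_{-i}\times T^0$, $\mathcal T=\mathcal T_{-i}\otimes\mathcal T^0$ for a $\sigma$-algebra $\mathcal T_{-i}$ on $T_{-i}$; $(t_{-i},t_i')$ denotes the profile equal to $t_i'$ at $i$ and to $t$ elsewhere. $S$ is a complete separable metric space of states with Borel $\sigma$-algebra $\mathcal S$. $(\Omega,\mathcal F,P)$ is a probability space with $(\Omega,\mathcal F)=(S\times T,\mathcal S\otimes\mathcal T)$; $P^S,P^T$ are the marginals of $P$ on $S$ and $T$. $\tilde s:\Omega\to S$ and $\tilde t_i:\Omega\to T^0$ are the projections $\tilde s(s,t)=s$, $\tilde t_i(s,t)=t_i$. $\mathcal C$ is the sub-$\sigma$-algebra of $\mathcal F$ generated by $\tilde s$ and the $P$-null sets. $(I\times\Omega,\mathcal I\boxtimes\mathcal F,\lambda\boxtimes P)$ is a Fubini extension. $\mathcal I\boxtimes\mathcal T$ is the $\sigma$-algebra of sets $D\subseteq I\times T$ such that $\{(i,(s,t))\in I\times\Omega:(i,t)\in D\}\in\mathcal I\boxtimes\mathcal F$, and $(\lambda\boxtimes P^T)(D)$ is the $\lambda\boxtimes P$-measure of that set. For $i\in I$, $\tau_i$ is the distribution of $\tilde t_i$ on $T^0$, and $P^{S\times T_{-i}}(\cdot|t_i)$ is the conditional probability on $(S\times T_{-i},\mathcal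 S\otimes\mathcal T_{-i})$ given that agent $i$'s signal is $t_i$: when $\tau_i(\{t_i\})>0$, $P^{S\times T_{-i}}(D|t_i)=P(D\times\{t_i\})/\tau_i(\{t_i\})$. The signal process $f:I\times\Omega\to T^0$, $f(i,\omega)=\tilde t_i(\omega)$, is assumed $\mathcal I\boxtimes\mathcal F$-measurable, with $f_\omega=f(\cdot,\omega)$ $\mathcal I$-measurable for each $\omega\in\Omega$, and essentially pairwise conditionally independent given $\mathcal C$: for $\lambda$-almost all $i_1$, for $\lambda$-almost all $i_2$, $P(f_{i_1}\in B_1,f_{i_2}\in B_2|\mathcal C)=P(f_{i_1}\in B_1|\mathcal C)P(f_{i_2}\in B_2|\mathcal C)$ for all $B_1,B_2\subseteq T^0$. Let $\mu$ be a regular conditional distribution of $f$ given $\mathcal I\otimes\mathcal C$, and $\bar\mu=\int_I\mu_i\,d\lambda(i)$, a $\mathcal C$-measurable map from $\Omega$ to $\Delta^0$. Non-triviality assumption: the sub-$\sigma$-algebra of $\mathcal F$ generated by $\bar\mu$ and the $P$-null sets equals $\mathcal C$. Assumptions on the economy (consumption set $\mathbb R_+^m$). A1: $u:I\times\mathbb R_+^m\times S\to\mathbb R_+$; for each $x$, $(i,s)\mapsto u(i,x,s)$ is $\mathcal I\otimes\mathcal S$-measurable; there are constants $c,d\in\mathbb R_+$ such that for each $(i,s)$, $x\mapsto u(i,x,s)$ is continuous, monotonic ($x\le y$, $x\ne y$ imply $u(i,x,s)<u(i,y,s)$), and $u(i,x,s)\le c\|x\|+d$ for all $x\in\mathbb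 R_+^m$ (Euclidean norm). A2: for each $(i,s)$, $u(i,\cdot,s)$ is concave on $\mathbb R_+^m$. A2$'$: for each $(i,s)$, $u(i,\cdot,s)$ is strictly concave on $\mathbb R_+^m$. A3: $e:I\to\mathbb R_+^m$ is $\lambda$-integrable (initial endowments). The collection $\mathcal E^p=\{(I\times\Omega,\mathcal I\boxtimes\mathcal F,\lambda\boxtimes P),u,e,f,\tilde s\}$ is called a private information economy. Definitions. For $z\in L^1(P^T,\mathbb R_+^m)$, $U^p_i(z)=\int_\Omega u(i,z(t),s)\,dP$. An allocation is an integrable function $x^p$ from $(I\times T,\mathcal I\boxtimes\mathcal T,\lambda\boxtimes P^T)$ to $\mathbb R_+^m$; $x^p_i=x^p(i,\cdot)$. It is feasible if $\int_I x^p(i,t)\,d\lambda(i)=\int_I e(i)\,d\lambda(i)$ for $P^T$-almost all $t$. A feasible allocation $x^p$ is ex ante efficient if there is no feasible allocation $y^p$ with $U^p_i(y^p_i)>U^p_i(x^p_i)$ for $\lambda$-almost all $i$. Allocations $x^p,y^p$ are utility equivalent if $U^p_i(x^p_i)=U^p_i(y^p_i)$ for $\lambda$-almost all $i$, and essentially equivalent if for $\lambda$-almost all $i$, $x^p_i(t)=y^p_i(t)$ for $P^T$-almost all $t$. For an allocation $x^p$ and $t_i,t_i'\in T^0$, let $U_i(x^p_i,t_i'|t_i)=\int_{S\times T_{-i}}u(i,x^p_i(t_{-i},t_i'),s)\,dP^{S\times T_{-i}}(\cdot|t_i)$. The allocation $x^p$ is incentive compatible if for $\lambda$-almost all $i$,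 $U_i(x^p_i,t_i|t_i)\ge U_i(x^p_i,t_i'|t_i)$ for all $t_i,t_i'\in T^0$ with $\tau_i(\{t_i\})>0$ and $\tau_i(\{t_i'\})>0$. *)

theory Defs
  imports "HOL-Probability.Probability"
begin

section \<open>Measure-theoretic notions\<close>

definition atomless :: "'a measure \<Rightarrow> bool" where
  "atomless M \<longleftrightarrow>
     (\<forall>A\<in>sets M. 0 < emeasure M A \<longrightarrow>
        (\<exists>B\<in>sets M. B \<subseteq> A \<and> 0 < emeasure M B \<and> emeasure M B < emeasure M A))"

definition fubini_extension :: "'a measure \<Rightarrow> 'b measure \<Rightarrow> ('a \<times> 'b) measure \<Rightarrow> bool" where
  "fubini_extension M N Q \<longleftrightarrow>
     prob_space Q \<and> complete_measure Q \<and>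
     space Q = space M \<times> space N \<and>
     sets (M \<Otimes>\<^sub>M N) \<subseteq> sets Q \<and>
     (\<forall>A\<in>sets (M \<Otimes>\<^sub>M N). emeasure Q A = emeasure (M \<Otimes>\<^sub>M N) A) \<and>
     (\<forall>h::'a \<times> 'b \<Rightarrow> real. integrable Q h \<longrightarrow>
        (AE i in M. integrable N (\<lambda>\<omega>. h (i, \<omega>))) \<and>
        (AE \<omega> in N. integrable M (\<lambda>i. h (i, \<omega>))) \<and>
        integrable M (\<lambda>i. \<integral>\<omega>. h (i, \<omega>) \<partial>N) \<and>
        integrable N (\<lambda>\<omega>. \<integral>i. h (i, \<omega>) \<partial>M) \<and>
        (\<integral>p. h p \<partial>Q) = (\<integral>i. (\<integral>\<omega>. h (i, \<omega>) \<partial>N) \<partial>M) \<and>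
        (\<integral>p. h p \<partial>Q) = (\<integral>\<omega>. (\<integral>i. h (i, \<omega>) \<partial>M) \<partial>N))"

text \<open>The sub-\<open>\<sigma>\<close>-algebra of \<open>M\<close> generated by \<open>X\<close> (with values in \<open>N\<close>) and the \<open>M\<close>-null sets.
  Only the space and the sets of this measure matter.\<close>

definition gen_sub_algebra :: "'a measure \<Rightarrow> 'b measure \<Rightarrow> ('a \<Rightarrow> 'b) \<Rightarrow> 'a measure" where
  "gen_sub_algebra M N X =
     sigma (space M) ({X -` A \<inter> space M | A. A \<in> sets N} \<union> null_sets M)"

text \<open>Regular conditional distribution of \<open>X\<close> (with values in \<open>N\<close>) under \<open>M\<close> given the
  sub-\<open>\<sigma>\<close>-algebra \<open>G\<close>.\<close>

definition regular_cond_distr ::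
  "'a measure \<Rightarrow> 'a measure \<Rightarrow> 'b measure \<Rightarrow> ('a \<Rightarrow> 'b) \<Rightarrow> ('a \<Rightarrow> 'b measure) \<Rightarrow> bool" where
  "regular_cond_distr M G N X \<mu> \<longleftrightarrow>
     \<mu> \<in> measurable G (prob_algebra N) \<and>
     (\<forall>B\<in>sets N. AE \<omega> in M.
        measure (\<mu> \<omega>) B = real_cond_exp M G (indicator (X -` B \<inter> space M)) \<omega>)"

definition strictly_concave_on :: "'a::real_vector set \<Rightarrow> ('a \<Rightarrow> real) \<Rightarrow> bool" where
  "strictly_concave_on C g \<longleftrightarrow> convex C \<and>
     (\<forall>x\<in>C. \<forall>y\<in>C. \<forall>\<theta>. x \<noteq> y \<and> 0 < \<theta> \<and> \<theta> < 1 \<longrightarrow>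
        (1 - \<theta>) * g x + \<theta> * g y < g ((1 - \<theta>) *\<^sub>R x + \<theta> *\<^sub>R y))"


section \<open>Private information economies\<close>

text \<open>The agent space, the state space and the signal set are the whole types \<open>'i\<close>, \<open>'s\<close> and
  \<open>'q\<close>; the commodity space is \<open>real ^ 'm\<close>. Signal profiles form the set \<open>space (profiles E)\<close>.
  A restriction \<open>t\<^sub>-\<^sub>i\<close> is the function \<open>restrict t (- {i})\<close>, so that \<open>(t\<^sub>-\<^sub>i, q)\<close> is
  \<open>(restrict t (- {i}))(i := q)\<close>. The measures \<open>profiles E\<close> and \<open>others E i\<close> only carry the
  \<open>\<sigma>\<close>-algebras \<open>\<T>\<close> and \<open>\<T>\<^sub>-\<^sub>i\<close>. The field \<open>joint\<close> is the measure on the uncompleted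
  product of the Borel sets with \<open>\<T>\<close>; notions relative to \<open>P\<close> use its completion.\<close>

record ('i, 's, 'q, 'm::finite) economy =
  agents :: "'i measure"
  profiles :: "('i \<Rightarrow> 'q) measure"
  others :: "'i \<Rightarrow> ('i \<Rightarrow> 'q) measure"
  joint :: "('s \<times> ('i \<Rightarrow> 'q)) measure"
  fubini :: "('i \<times> 's \<times> ('i \<Rightarrow> 'q)) measure"
  utility :: "'i \<Rightarrow> real ^ 'm \<Rightarrow> 's \<Rightarrow> real"
  endowment :: "'i \<Rightarrow> real ^ 'm"

definition state_proj :: "'s \<times> ('i \<Rightarrow> 'q) \<Rightarrow> 's" where
  "state_proj \<omega> = fst \<omega>"

definition signal_proj :: "'i \<Rightarrow> 's \<times> ('i \<Rightarrow> 'q) \<Rightarrow> 'q" where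
  "signal_proj i \<omega> = snd \<omega> i"

definition signal_process :: "'i \<times> 's \<times> ('i \<Rightarrow> 'q) \<Rightarrow> 'q" where
  "signal_process = (\<lambda>(i, \<omega>). signal_proj i \<omega>)"

definition completed_prob :: "('i, 's, 'q, 'm::finite) economy \<Rightarrow> ('s \<times> ('i \<Rightarrow> 'q)) measure" where
  "completed_prob E = completion (joint E)"

definition prob_T :: "('i, 's, 'q, 'm::finite) economy \<Rightarrow> ('i \<Rightarrow> 'q) measure" where
  "prob_T E = distr (joint E) (profiles E) snd"

text \<open>The space \<open>(I \<times> T, \<I> \<boxtimes> \<T>, \<lambda> \<boxtimes> P\<^sup>T)\<close>.\<close>

definition fubini_T :: "('i, 's, 'q, 'm::finite) economy \<Rightarrow> ('i \<times> ('i \<Rightarrow> 'q)) measure" where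
  "fubini_T E =
     (let pre = (\<lambda>D. {(i, s, t). (i, s, t) \<in> space (fubini E) \<and> (i, t) \<in> D})
      in measure_of (UNIV \<times> space (profiles E))
           {D. D \<subseteq> UNIV \<times> space (profiles E) \<and> pre D \<in> sets (fubini E)}
           (\<lambda>D. emeasure (fubini E) (pre D)))"

text \<open>The distribution \<open>\<tau>\<^sub>i\<close> of agent \<open>i\<close>'s signal.\<close>

definition signal_distr :: "('i, 's, 'q, 'm::finite) economy \<Rightarrow> 'i \<Rightarrow> 'q measure" where
  "signal_distr E i = distr (joint E) (count_space UNIV) (signal_proj i)"

text \<open>The conditional probability on \<open>S \<times> T\<^sub>-\<^sub>i\<close> given that agent \<open>i\<close>'s signal is \<open>q\<close>; it is only
  meaningful if \<open>q\<close> has positive probability.\<close>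

definition cond_prob_others ::
  "('i, 's::polish_space, 'q, 'm::finite) economy \<Rightarrow> 'i \<Rightarrow> 'q \<Rightarrow> ('s \<times> ('i \<Rightarrow> 'q)) measure" where
  "cond_prob_others E i q =
     distr (uniform_measure (joint E) {\<omega>\<in>space (joint E). signal_proj i \<omega> = q})
       (borel \<Otimes>\<^sub>M others E i) (\<lambda>(s, t). (s, restrict t (- {i})))"

text \<open>The \<open>\<sigma>\<close>-algebra \<open>\<C>\<close>.\<close>

definition state_algebra ::
  "('i, 's::polish_space, 'q, 'm::finite) economy \<Rightarrow> ('s \<times> ('i \<Rightarrow> 'q)) measure" where
  "state_algebra E = gen_sub_algebra (completed_prob E) borel state_proj"

definition ess_pairwise_cond_indep :: "('i, 's::polish_space, 'q, 'm::finite) economy \<Rightarrow> bool" where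
  "ess_pairwise_cond_indep E \<longleftrightarrow>
     (let cp = (\<lambda>A. real_cond_exp (completed_prob E) (state_algebra E) (indicator A))
      in AE i1 in agents E. AE i2 in agents E. \<forall>B1 B2. AE \<omega> in completed_prob E.
           cp {\<omega>\<in>space (completed_prob E). signal_proj i1 \<omega> \<in> B1 \<and> signal_proj i2 \<omega> \<in> B2} \<omega> =
           cp {\<omega>\<in>space (completed_prob E). signal_proj i1 \<omega> \<in> B1} \<omega> *
           cp {\<omega>\<in>space (completed_prob E). signal_proj i2 \<omega> \<in> B2} \<omega>)"

text \<open>The averaged conditional distribution is the Giry bind of \<open>\<lambda>\<close> with the kernel
  \<open>i \<mapsto> \<mu> (i, \<omega>)\<close>, i.e. it maps \<open>B\<close> to the integral of \<open>\<mu> (i, \<omega>) B\<close> over \<open>i\<close>. The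
  choice of the version \<open>\<mu>\<close> does not affect the generated \<open>\<sigma>\<close>-algebra, as it contains the null sets.\<close>

definition nontrivial_signals :: "('i, 's::polish_space, 'q::finite, 'm::finite) economy \<Rightarrow> bool" where
  "nontrivial_signals E \<longleftrightarrow>
     (\<exists>\<mu>. regular_cond_distr (fubini E) (agents E \<Otimes>\<^sub>M state_algebra E)
            (count_space UNIV) signal_process \<mu> \<and>
          sets (gen_sub_algebra (completed_prob E) (prob_algebra (count_space (UNIV :: 'q set)))
                  (\<lambda>\<omega>. Giry_Monad.bind (agents E) (\<lambda>i. \<mu> (i, \<omega>)))) =
          sets (state_algebra E))"

text \<open>The assumptions \<open>others_image\<close> and \<open>profiles_sets\<close> say that \<open>t \<mapsto> (t\<^sub>-\<^sub>i, t\<^sub>i)\<close> identifies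
  \<open>(T, \<T>)\<close> with the product of \<open>(T\<^sub>-\<^sub>i, \<T>\<^sub>-\<^sub>i)\<close> and the discrete signal set.\<close>

locale private_information_economy =
  fixes E :: "('i, 's::polish_space, 'q::finite, 'm::finite) economy"
  assumes agents_space: "space (agents E) = UNIV"
    and agents_prob: "prob_space (agents E)"
    and agents_complete: "complete_measure (agents E)"
    and agents_atomless: "atomless (agents E)"
    and others_space:
      "\<And>i. space (others E i) = (\<lambda>t. restrict t (- {i})) ` space (profiles E)"
    and others_image:
      "\<And>i. (\<lambda>t. (restrict t (- {i}), t i)) ` space (profiles E) = space (others E i) \<times> UNIV"
    and profiles_sets:
      "\<And>i. sets (profiles E) =
         sets (vimage_algebra (space (profiles E)) (\<lambda>t. (restrict t (- {i}), t i))
                 (others E i \<Otimes>\<^sub>M count_space UNIV))"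
    and joint_prob: "prob_space (joint E)"
    and joint_sets: "sets (joint E) = sets (borel \<Otimes>\<^sub>M profiles E)"
    and fubini: "fubini_extension (agents E) (completed_prob E) (fubini E)"
    and signal_process_measurable:
      "signal_process \<in> measurable (fubini E) (count_space UNIV)"
    and signal_sections_measurable:
      "\<And>\<omega>. \<omega> \<in> space (joint E) \<Longrightarrow>
         (\<lambda>i. signal_process (i, \<omega>)) \<in> measurable (agents E) (count_space UNIV)"
    and cond_indep: "ess_pairwise_cond_indep E"
    and nontrivial: "nontrivial_signals E"
    and utility_nonneg: "\<And>i x s. 0 \<le> x \<Longrightarrow> 0 \<le> utility E i x s"
    and endowment_nonneg: "\<And>i. 0 \<le> endowment E i"

text \<open>The order on \<open>real ^ 'm\<close> is the componentwise one, so \<open>{x. 0 \<le> x}\<close> is the nonnegative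
  orthant.\<close>

definition assumption_A1 :: "('i, 's::polish_space, 'q, 'm::finite) economy \<Rightarrow> bool" where
  "assumption_A1 E \<longleftrightarrow>
     (\<forall>x\<ge>0. (\<lambda>(i, s). utility E i x s) \<in> borel_measurable (agents E \<Otimes>\<^sub>M borel)) \<and>
     (\<exists>c\<ge>0. \<exists>d\<ge>0. \<forall>i s.
        continuous_on {x. 0 \<le> x} (\<lambda>x. utility E i x s) \<and>
        (\<forall>x\<ge>0. \<forall>y\<ge>0. x \<le> y \<and> x \<noteq> y \<longrightarrow> utility E i x s < utility E i y s) \<and>
        (\<forall>x\<ge>0. utility E i x s \<le> c * norm x + d))"

definition assumption_A2 :: "('i, 's, 'q, 'm::finite) economy \<Rightarrow> bool" where
  "assumption_A2 E \<longleftrightarrow> (\<forall>i s. concave_on {x. 0 \<le> x} (\<lambda>x. utility E i x s))"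

definition assumption_A2' :: "('i, 's, 'q, 'm::finite) economy \<Rightarrow> bool" where
  "assumption_A2' E \<longleftrightarrow> (\<forall>i s. strictly_concave_on {x. 0 \<le> x} (\<lambda>x. utility E i x s))"

definition assumption_A3 :: "('i, 's, 'q, 'm::finite) economy \<Rightarrow> bool" where
  "assumption_A3 E \<longleftrightarrow> integrable (agents E) (endowment E)"


section \<open>Allocations\<close>

type_synonym ('i, 'q, 'm) alloc = "'i \<Rightarrow> ('i \<Rightarrow> 'q) \<Rightarrow> real ^ 'm"

definition ex_ante_utility ::
  "('i, 's, 'q, 'm::finite) economy \<Rightarrow> 'i \<Rightarrow> (('i \<Rightarrow> 'q) \<Rightarrow> real ^ 'm) \<Rightarrow> real" where
  "ex_ante_utility E i z = (\<integral>(s, t). utility E i (z t) s \<partial>completed_prob E)"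

definition allocation ::
  "('i, 's, 'q, 'm::finite) economy \<Rightarrow> ('i, 'q, 'm) alloc \<Rightarrow> bool" where
  "allocation E x \<longleftrightarrow>
     (\<forall>i. \<forall>t\<in>space (profiles E). 0 \<le> x i t) \<and> integrable (fubini_T E) (\<lambda>(i, t). x i t)"

definition feasible ::
  "('i, 's, 'q, 'm::finite) economy \<Rightarrow> ('i, 'q, 'm) alloc \<Rightarrow> bool" where
  "feasible E x \<longleftrightarrow>
     allocation E x \<and>
     (AE t in prob_T E. (\<integral>i. x i t \<partial>agents E) = (\<integral>i. endowment E i \<partial>agents E))"

definition ex_ante_efficient ::
  "('i, 's, 'q, 'm::finite) economy \<Rightarrow> ('i, 'q, 'm) alloc \<Rightarrow> bool" where
  "ex_ante_efficient E x \<longleftrightarrow>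
     feasible E x \<and>
     \<not> (\<exists>y. feasible E y \<and>
          (AE i in agents E. ex_ante_utility E i (y i) > ex_ante_utility E i (x i)))"

definition utility_equivalent ::
  "('i, 's, 'q, 'm::finite) economy \<Rightarrow> ('i, 'q, 'm) alloc \<Rightarrow> ('i, 'q, 'm) alloc \<Rightarrow> bool" where
  "utility_equivalent E x y \<longleftrightarrow>
     (AE i in agents E. ex_ante_utility E i (x i) = ex_ante_utility E i (y i))"

definition essentially_equivalent ::
  "('i, 's, 'q, 'm::finite) economy \<Rightarrow> ('i, 'q, 'm) alloc \<Rightarrow> ('i, 'q, 'm) alloc \<Rightarrow> bool" where
  "essentially_equivalent E x y \<longleftrightarrow>
     (AE i in agents E. AE t in prob_T E. x i t = y i t)"

text \<open>\<open>reported_utility_integrand E x i q'\<close> maps \<open>(s, t\<^sub>-\<^sub>i)\<close> to agent \<open>i\<close>'s utility when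
  reporting \<open>q'\<close>, and \<open>interim_utility E x i q' q\<close> is \<open>U\<^sub>i(x, q' | q)\<close>.\<close>

definition reported_utility_integrand ::
  "('i, 's, 'q, 'm::finite) economy \<Rightarrow> ('i, 'q, 'm) alloc \<Rightarrow> 'i \<Rightarrow> 'q \<Rightarrow>
     's \<times> ('i \<Rightarrow> 'q) \<Rightarrow> real" where
  "reported_utility_integrand E x i q' = (\<lambda>(s, r). utility E i (x i (r(i := q'))) s)"

definition interim_utility ::
  "('i, 's::polish_space, 'q, 'm::finite) economy \<Rightarrow> ('i, 'q, 'm) alloc \<Rightarrow> 'i \<Rightarrow> 'q \<Rightarrow> 'q \<Rightarrow> real" where
  "interim_utility E x i q' q =
     (\<integral>p. reported_utility_integrand E x i q' p \<partial>completion (cond_prob_others E i q))"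

text \<open>The integral defining \<open>U\<^sub>i(x, q' | q)\<close> may fail to exist, since \<open>x\<close> is only measurable up
  to null sets and the laws of the others' signals given \<open>q\<close> and \<open>q'\<close> may be mutually singular.
  A Bochner integral would then be 0 by convention and the inequality could hold vacuously;
  therefore incentive compatibility explicitly requires these integrals to exist.\<close>

definition incentive_compatible ::
  "('i, 's::polish_space, 'q, 'm::finite) economy \<Rightarrow> ('i, 'q, 'm) alloc \<Rightarrow> bool" where
  "incentive_compatible E x \<longleftrightarrow>
     (AE i in agents E. \<forall>q q'.
        measure (signal_distr E i) {q} > 0 \<and> measure (signal_distr E i) {q'} > 0 \<longrightarrow>
        integrable (completion (cond_prob_others E i q)) (reported_utility_integrand E x i q) \<and>
        integrable (completion (cond_prob_others E i q)) (reported_utility_integrand E x i q') \<and>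
        interim_utility E x i q q \<ge> interim_utility E x i q' q)"

end

theory Submission
  imports Defs
begin

text \<open>Averaging an efficient allocation over signals conditionally on the state does not hurt
  anybody, by Jensen's inequality, and preserves feasibility. By the exact law of large numbers
  and the non-triviality assumption, the state is almost surely a function of the empirical
  distribution of the signals, which no single agent can influence as the agent space is
  atomless. The averaged allocation can therefore be written as a function of the reported
  signals that ignores unilateral misreports. Since the original allocation is efficient, the
  average cannot be strictly better for a positive mass of agents.\<close>


section \<open>Vector-valued functions and joint measurability\<close>

text \<open>Three obstacles shape the development. Misreports may lead into a null set of profiles,
  so almost sure invariance under a unilateral change would say nothing about them; the new
  allocation therefore depends on the profile only through frequencies, which are the same for
  \<open>t\<close> and \<open>t(i := q)\<close> at every single profile. Secondly, the map from
  frequencies to the state comes from a choice and need not be measurable; measurability is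
  recovered from completeness, because the resulting allocation agrees almost everywhere with a
  measurable conditional expectation. A related gap lies between P and its marginal on profiles,
  where an almost sure property of the signal part has to yield a measurable set of profiles; here
  the Polish state space is used. Thirdly, efficiency excludes only reallocations that benefit
  almost every agent strictly, whereas averaging gives a weak improvement; a small charge on strict
  gainers, shared by all, bridges this by continuity and strict monotonicity. In the strictly
  concave case the same principle is applied to the midpoint of the two allocations.\<close>

lemma integrable_vec_iff:
  fixes f :: "'a \<Rightarrow> real ^ 'm::finite"
  shows "integrable M f \<longleftrightarrow> (\<forall>k. integrable M (\<lambda>x. f x $ k))"
proof
  assume "integrable M f"
  then show "\<forall>k. integrable M (\<lambda>x. f x $ k)"
    using integrable_bounded_linear[OF bounded_linear_vec_nth] by blast
next
  assume "\<forall>k. integrable M (\<lambda>x. f x $ k)"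
  then have "integrable M (\<lambda>x. \<Sum>k\<in>UNIV. f x $ k *\<^sub>R (axis k 1 :: real ^ 'm))"
    by (intro Bochner_Integration.integrable_sum integrable_scaleR_left) auto
  moreover have "(\<lambda>x. \<Sum>k\<in>UNIV. f x $ k *\<^sub>R (axis k 1 :: real ^ 'm)) = f"
    by (auto simp: vec_eq_iff axis_def if_distrib cong: if_cong)
  ultimately show "integrable M f" by simp
qed

lemma integral_vec_nth:
  fixes f :: "'a \<Rightarrow> real ^ 'm::finite"
  assumes "integrable M f"
  shows "(\<integral>x. f x \<partial>M) $ k = (\<integral>x. f x $ k \<partial>M)"
  using integral_bounded_linear[OF bounded_linear_vec_nth assms] by simp

lemma integral_vec_nonneg:
  fixes f :: "'a \<Rightarrow> real ^ 'm::finite"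
  assumes "AE x in M. 0 \<le> f x"
  shows "0 \<le> (\<integral>x. f x \<partial>M)"
proof (cases "integrable M f")
  case True
  have "0 \<le> (\<integral>x. f x $ k \<partial>M)" for k
    using assms by (intro integral_nonneg_AE) (auto simp: less_eq_vec_def)
  then show ?thesis by (simp add: less_eq_vec_def integral_vec_nth[OF True])
next
  \<comment> \<open>Without integrability the Bochner integral is 0 by convention.\<close>
  case False
  then show ?thesis by (simp add: not_integrable_integral_eq)
qed

lemma borel_measurable_vec_iff:
  fixes f :: "'a \<Rightarrow> real ^ 'm::finite"
  shows "f \<in> borel_measurable M \<longleftrightarrow> (\<forall>k. (\<lambda>x. f x $ k) \<in> borel_measurable M)"
proof
  assume "f \<in> borel_measurable M"
  then show "\<forall>k. (\<lambda>x. f x $ k) \<in> borel_measurable M"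
    by (intro allI borel_measurable_continuous_on[where f="\<lambda>x. x $ _"] continuous_intros) auto
next
  assume "\<forall>k. (\<lambda>x. f x $ k) \<in> borel_measurable M"
  then have "(\<lambda>x. \<Sum>k\<in>UNIV. f x $ k *\<^sub>R (axis k 1 :: real ^ 'm)) \<in> borel_measurable M"
    by (intro borel_measurable_sum borel_measurable_scaleR) auto
  moreover have "(\<lambda>x. \<Sum>k\<in>UNIV. f x $ k *\<^sub>R (axis k 1 :: real ^ 'm)) = f"
    by (auto simp: vec_eq_iff axis_def if_distrib cong: if_cong)
  ultimately show "f \<in> borel_measurable M" by simp
qed

text \<open>Joint measurability is reduced to fixed bundles: rounding \<open>z\<close> down to a
  grid takes only countably many values, so each rounded composition is measurable by a countable
  case split, and continuity in the bundle passes this to the limit.\<close>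

lemma caratheodory_measurable:
  fixes v :: "'a \<Rightarrow> real ^ 'm::finite \<Rightarrow> real"
  assumes meas: "\<And>x. 0 \<le> x \<Longrightarrow> (\<lambda>p. v p x) \<in> borel_measurable M"
    and cont: "\<And>p. p \<in> space M \<Longrightarrow> continuous_on {x. 0 \<le> x} (v p)"
    and z: "z \<in> borel_measurable M" and nonneg: "\<And>p. p \<in> space M \<Longrightarrow> 0 \<le> z p"
  shows "(\<lambda>p. v p (z p)) \<in> borel_measurable M"
proof -
  define fl where "fl n p = (\<lambda>k. \<lfloor>real (Suc n) * z p $ k\<rfloor>)" for n p
  \<comment> \<open>The index \<open>f\<close> runs over all integer vectors, also negative ones,
    while \<open>v\<close> is only controlled on the orthant; the \<open>max 0\<close> keeps every
    grid point inside and changes nothing at the rounded values of \<open>z\<close>.\<close>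
  define d :: "nat \<Rightarrow> ('m \<Rightarrow> int) \<Rightarrow> real ^ 'm"
    where "d n f = (\<chi> k. real_of_int (max 0 (f k)) / real (Suc n))" for n f
  have zk: "(\<lambda>p. z p $ k) \<in> borel_measurable M" for k
    using z borel_measurable_vec_iff by blast
  have nn: "0 \<le> d n f" for n f by (auto simp: d_def less_eq_vec_def)
  have fl: "fl n \<in> measurable M (count_space UNIV)" for n
  proof (subst measurable_count_space_eq2_countable, intro conjI ballI)
    fix f :: "'m \<Rightarrow> int"
    have "fl n -` {f} \<inter> space M = {p \<in> space M. \<forall>k. \<lfloor>real (Suc n) * z p $ k\<rfloor> = f k}"
      by (auto simp: fl_def)
    also have "\<dots> \<in> sets M" using zk by measurable
    finally show "fl n -` {f} \<inter> space M \<in> sets M" .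
  qed auto
  have "(\<lambda>p. v p (d n (fl n p))) \<in> borel_measurable M" for n
    by (rule measurable_compose_countable[OF _ fl, where f="\<lambda>f p. v p (d n f)"])
       (use meas nn in auto)
  moreover have "(\<lambda>n. v p (d n (fl n p))) \<longlonglongrightarrow> v p (z p)" if p: "p \<in> space M" for p
  proof -
    have "(\<lambda>n. d n (fl n p)) \<longlonglongrightarrow> z p"
    proof (rule vec_tendstoI)
      fix k
      have zk0: "0 \<le> z p $ k" using nonneg[OF p] by (simp add: less_eq_vec_def)
      have eq: "d n (fl n p) $ k = real_of_int \<lfloor>real (Suc n) * z p $ k\<rfloor> / real (Suc n)" for n
        using zk0 by (simp add: d_def fl_def max_def)
      have lo: "z p $ k - 1 / real (Suc n) \<le> d n (fl n p) $ k"
        and hi: "d n (fl n p) $ k \<le> z p $ k" for n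
      proof -
        define N where "N = real (Suc n)"
        have N: "0 < N" by (simp add: N_def)
        have "(N * z p $ k - 1) / N \<le> real_of_int \<lfloor>N * z p $ k\<rfloor> / N"
          using N by (intro divide_right_mono) linarith+
        moreover have "(N * z p $ k - 1) / N = z p $ k - 1 / N"
          using N by (simp add: diff_divide_distrib)
        ultimately show "z p $ k - 1 / real (Suc n) \<le> d n (fl n p) $ k"
          unfolding eq N_def by (simp only:)
        have "real_of_int \<lfloor>N * z p $ k\<rfloor> / N \<le> N * z p $ k / N"
          using N by (intro divide_right_mono) linarith+
        moreover have "N * z p $ k / N = z p $ k"
          using N by simp
        ultimately show "d n (fl n p) $ k \<le> z p $ k"
          unfolding eq N_def by (simp only:)
      qed
      have l: "(\<lambda>n. z p $ k - 1 / real (Suc n)) \<longlonglongrightarrow> z p $ k"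
        using tendsto_diff[OF tendsto_const LIMSEQ_Suc[OF lim_1_over_n], of "z p $ k"] by simp
      show "(\<lambda>n. d n (fl n p) $ k) \<longlonglongrightarrow> z p $ k"
        by (rule tendsto_sandwich[OF _ _ l tendsto_const]) (rule always_eventually, rule allI, rule lo hi)+
    qed
    moreover have "\<forall>n. d n (fl n p) \<in> {x. 0 \<le> x}" using nn by auto
    ultimately show ?thesis
      using cont[OF p] nonneg[OF p] unfolding continuous_on_sequentially comp_def by auto
  qed
  ultimately show ?thesis by (rule borel_measurable_LIMSEQ_real[rotated])
qed


text \<open>\<open>T\<close> need not be countably generated, but a single product-measurable set
  involves only countably many sets of \<open>T\<close>. Their indicator sequence maps the space of
  \<open>T\<close> into \<open>nat \<Rightarrow> real\<close>, so that questions about the set move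
  to a Borel set, which lives in a Polish space whenever the state space is Polish.\<close>

lemma sets_pair_countably_determined:
  assumes "C \<in> sets (borel \<Otimes>\<^sub>M T)"
  shows "\<exists>(A :: nat \<Rightarrow> _) C'. range A \<subseteq> sets T \<and> C' \<in> sets (borel :: ('s::second_countable_topology \<times> (nat \<Rightarrow> real)) measure) \<and>
    (\<forall>s. \<forall>t\<in>space T. (s, t) \<in> C \<longleftrightarrow> (s, \<lambda>n. indicat_real (A n) t) \<in> C')"
proof -
  have "C \<in> sigma_sets (space borel \<times> space T) {a \<times> b |a b. a \<in> sets borel \<and> b \<in> sets T}"
    using assms by (simp add: sets_pair_measure)
  then show ?thesis
  proof induction
    case (Basic c)
    then obtain a b where ab: "c = a \<times> b" "a \<in> sets borel" "b \<in> sets T" by auto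
    have "(\<lambda>x::nat \<Rightarrow> real. x 0) \<in> borel_measurable borel"
      by (intro borel_measurable_continuous_onI continuous_on_product_coordinates)
    then have B: "{x :: nat \<Rightarrow> real. x 0 = 1} \<in> sets borel"
      using measurable_sets[of "\<lambda>x::nat \<Rightarrow> real. x 0" borel borel "{1}"] by (simp add: vimage_def)
    have "a \<times> {x :: nat \<Rightarrow> real. x 0 = 1} \<in> sets borel"
      using ab B by (intro borel_Times)
    with ab show ?case
      by (intro exI[of _ "\<lambda>_. b"] exI[of _ "a \<times> {x. x 0 = 1}"]) (auto simp: indicator_def)
  next
    case Empty
    show ?case by (intro exI[of _ "\<lambda>_. {}"] exI[of _ "{}"]) auto
  next
    case (Compl c)
    then obtain A :: "nat \<Rightarrow> _" and C' :: "('s \<times> (nat \<Rightarrow> real)) set" where "range A \<subseteq> sets T" "C' \<in> sets borel"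
      "\<forall>s. \<forall>t\<in>space T. (s, t) \<in> c \<longleftrightarrow> (s, \<lambda>n. indicat_real (A n) t) \<in> C'" by auto
    then show ?case by (intro exI[of _ A] exI[of _ "- C'"]) auto
  next
    case (Union c)
    then have "\<forall>i. \<exists>(A :: nat \<Rightarrow> _) C'. range A \<subseteq> sets T \<and> C' \<in> sets (borel :: ('s \<times> (nat \<Rightarrow> real)) measure) \<and>
       (\<forall>s. \<forall>t\<in>space T. (s, t) \<in> c i \<longleftrightarrow> (s, \<lambda>n. indicat_real (A n) t) \<in> C')" by auto
    then obtain A :: "nat \<Rightarrow> nat \<Rightarrow> _" and C' :: "nat \<Rightarrow> ('s \<times> (nat \<Rightarrow> real)) set" where AC: "\<And>i. range (A i) \<subseteq> sets T" "\<And>i. C' i \<in> sets borel"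
       "\<And>i s t. t \<in> space T \<Longrightarrow> (s, t) \<in> c i \<longleftrightarrow> (s, \<lambda>n. indicat_real (A i n) t) \<in> C' i"
      by metis
    \<comment> \<open>\<open>prod_decode\<close> merges countably many sequences of sets into one;
      \<open>D i\<close> reads the i-th sequence back at the indices
      \<open>prod_encode (i, n)\<close>.\<close>
    define A' where "A' n = case_prod A (prod_decode n)" for n
    define D where "D i = (\<lambda>q :: 's \<times> (nat \<Rightarrow> real). (fst q, \<lambda>n. snd q (prod_encode (i, n)))) -` C' i" for i
    have "(\<lambda>q :: 's \<times> (nat \<Rightarrow> real). (fst q, \<lambda>n. snd q (prod_encode (i, n)))) \<in> borel_measurable borel" for i
      by (intro borel_measurable_continuous_onI continuous_intros continuous_on_coordinatewise_then_product
          continuous_on_product_then_coordinatewise[where f=snd])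
    then have "D i \<in> sets borel" for i
      unfolding D_def using measurable_sets[OF _ AC(2)[of i], of _ borel] by fastforce
    moreover have "range A' \<subseteq> sets T" using AC(1) by (auto simp: A'_def split: prod.split)
    moreover have "(s, t) \<in> c i \<longleftrightarrow> (s, \<lambda>n. indicat_real (A' n) t) \<in> D i" if "t \<in> space T" for i s t
      using that AC(3)[of t s i] by (simp add: D_def A'_def)
    ultimately show ?case by (intro exI[of _ A'] exI[of _ "\<Union>i. D i"]) auto
  qed
qed

text \<open>A measurable set of full measure contains, up to a small error, the preimage of a compact
  set, whose projection is compact and hence measurable.\<close>

lemma AE_distr_snd:
  fixes J :: "('s::polish_space \<times> 'b) measure"
  assumes "prob_space J" and sets: "sets J = sets (borel \<Otimes>\<^sub>M T)"
    and AE: "AE \<omega> in J. R (snd \<omega>)"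
  shows "AE t in distr J T snd. R t"
proof -
  interpret prob_space J by fact
  have spJ: "space J = UNIV \<times> space T"
    using sets_eq_imp_space_eq[OF sets] by (simp add: space_pair_measure)
  have sndm[measurable]: "snd \<in> measurable J T"
    unfolding measurable_cong_sets[OF sets refl] by (rule measurable_snd)
  obtain C where C: "C \<in> sets J" "prob C = 1" "\<And>\<omega>. \<omega> \<in> C \<Longrightarrow> R (snd \<omega>)"
  proof -
    obtain S where S: "S \<subseteq> {\<omega>\<in>space J. R (snd \<omega>)}" "S \<in> sets J" "prob S = 1"
      by (rule AE_E_prob[OF AE])
    then show thesis by (intro that[of S]) blast+
  qed
  obtain A C' where A: "range A \<subseteq> sets T" and C': "C' \<in> sets (borel :: ('s \<times> (nat \<Rightarrow> real)) measure)"
    and eq: "\<And>s t. t\<in>space T \<Longrightarrow> (s, t) \<in> C \<longleftrightarrow> (s, \<lambda>n. indicat_real (A n) t) \<in> C'"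
    using sets_pair_countably_determined[of C T] C(1) sets by metis
  define h where "h t = (\<lambda>n. indicat_real (A n) t)" for t
  have An: "A n \<in> sets T" for n using A by auto
  have hm[measurable]: "h \<in> borel_measurable T"
    unfolding h_def using An by (intro measurable_coordinatewise_then_product) auto
  define g where "g \<omega> = (fst \<omega>, h (snd \<omega>))" for \<omega> :: "'s \<times> 'b"
  have fstm[measurable]: "fst \<in> borel_measurable J"
    unfolding measurable_cong_sets[OF sets refl] by (rule measurable_fst)
  have gm[measurable]: "g \<in> borel_measurable J"
    unfolding g_def borel_prod[symmetric] by (intro measurable_Pair fstm measurable_compose[OF sndm hm])
  \<comment> \<open>Inner regularity by compact sets is applied to this law, which lives on the
    Polish space \<open>'s \<times> (nat \<Rightarrow> real)\<close>; the space of \<open>T\<close>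
    itself carries no topology.\<close>
  define L where "L = distr J borel g"
  interpret L: prob_space L unfolding L_def by (rule prob_space_distr) simp
  have vC: "g -` C' \<inter> space J = C"
  proof (rule set_eqI)
    fix \<omega> :: "'s \<times> 'b"
    have "\<omega> \<in> C \<Longrightarrow> \<omega> \<in> space J" using C(1) sets.sets_into_space by blast
    moreover have "\<omega> \<in> space J \<Longrightarrow> snd \<omega> \<in> space T" unfolding spJ by (rule mem_Times_iff[THEN iffD1, THEN conjunct2])
    moreover have "\<omega> = (fst \<omega>, snd \<omega>)" by simp
    ultimately show "\<omega> \<in> g -` C' \<inter> space J \<longleftrightarrow> \<omega> \<in> C"
      using eq[of "snd \<omega>" "fst \<omega>"] unfolding vimage_eq Int_iff g_def h_def by metis
  qed
  have LC: "emeasure L C' = 1"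
    using C(1,2) C' vC by (simp add: L_def emeasure_distr emeasure_eq_measure)
  have "\<exists>K. K \<subseteq> C' \<and> compact K \<and> emeasure L K > ennreal (1 - 1 / real (Suc n))" for n
  proof -
    have "(SUP K \<in> {K. K \<subseteq> C' \<and> compact K}. emeasure L K) = 1"
      using inner_regular[of L C'] C' LC L.emeasure_finite by (auto simp: L_def)
    then have "ennreal (1 - 1 / real (Suc n)) < (SUP K \<in> {K. K \<subseteq> C' \<and> compact K}. emeasure L K)"
      by (simp add: ennreal_less_one_iff)
    then show ?thesis unfolding less_SUP_iff by auto
  qed
  then obtain K where K: "\<And>n. K n \<subseteq> C'" "\<And>n. compact (K n)"
    "\<And>n. emeasure L (K n) > ennreal (1 - 1 / real (Suc n))" by metis
  define B where "B n = h -` (snd ` K n) \<inter> space T" for n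
  have Ks: "snd ` K n \<in> sets borel" for n
    using K(2) by (intro borel_closed compact_imp_closed compact_continuous_image continuous_on_snd continuous_on_id)
  have Bs: "B n \<in> sets T" for n
    unfolding B_def using measurable_sets[OF hm Ks[of n]] .
  have R: "R t" if "t \<in> B n" for n t
  proof -
    from that obtain s where "(s, h t) \<in> K n" "t \<in> space T" by (auto simp: B_def)
    with K(1) have "(s, t) \<in> C" using eq[of t s] by (auto simp: h_def)
    with C(3) show ?thesis by fastforce
  qed
  interpret D: prob_space "distr J T snd" by (rule prob_space_distr) simp
  have "D.prob (B n) > 1 - 1 / real (Suc n)" for n
  proof -
    have "emeasure L (K n) \<le> emeasure J (snd -` B n \<inter> space J)"
      unfolding L_def
    proof (subst emeasure_distr[OF gm borel_closed[OF compact_imp_closed[OF K(2)]]], rule emeasure_mono)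
      show "g -` K n \<inter> space J \<subseteq> snd -` B n \<inter> space J"
        unfolding B_def g_def spJ by (auto simp: image_iff Bex_def intro!: exI[of _ "(_, _)"])
      show "snd -` B n \<inter> space J \<in> sets J"
        by (rule measurable_sets[OF sndm Bs])
    qed
    also have "\<dots> = emeasure (distr J T snd) (B n)"
      using Bs by (simp add: emeasure_distr)
    finally have "ennreal (1 - 1 / real (Suc n)) < ennreal (D.prob (B n))"
      using K(3)[of n] by (simp add: D.emeasure_eq_measure)
    then show ?thesis by (simp add: ennreal_less_iff)
  qed
  then have ge: "1 - 1 / real (Suc n) \<le> D.prob (\<Union>n. B n)" for n
    by (rule order_trans[OF less_imp_le D.finite_measure_mono]) (use Bs in auto)
  have "(\<lambda>n. 1 - 1 / real (Suc n)) \<longlonglongrightarrow> 1 - 0"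
    by (intro tendsto_diff tendsto_const LIMSEQ_Suc lim_1_over_n)
  then have "1 \<le> D.prob (\<Union>n. B n)"
    by (intro LIMSEQ_le_const2[of "\<lambda>n. 1 - 1 / real (Suc n)"]) (use ge in auto)
  then have "D.prob (\<Union>n. B n) = 1" using D.prob_le_1 by (metis order_antisym)
  then have "AE t in distr J T snd. t \<in> (\<Union>n. B n)"
    using Bs by (subst D.AE_in_set_eq_1) auto
  then show ?thesis by (rule AE_mp) (use R in auto)
qed


section \<open>Jensen's inequality on the orthant\<close>

text \<open>The point \<open>(x0, c)\<close> lies strictly above the hypograph, which is closed and
  convex, so a hyperplane separates them. A strict gap below \<open>c\<close> is asked for because a
  tangent at \<open>x0\<close> itself need not exist on the boundary of the orthant, as for a square
  root at 0.\<close>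

lemma concave_on_orthant_majorant:
  fixes u :: "real ^ 'm::finite \<Rightarrow> real"
  assumes conc: "concave_on {x. 0 \<le> x} u" and cont: "continuous_on {x. 0 \<le> x} u"
    and "0 \<le> x0" "u x0 < c"
  obtains a b where "\<And>x. 0 \<le> x \<Longrightarrow> u x \<le> inner a x + b" "inner a x0 + b < c"
proof -
  define H where "H = {(x, r). 0 \<le> x \<and> r \<le> u x}"
  have orth: "{x :: real ^ 'm. 0 \<le> x} = (\<Inter>k. {x. 0 \<le> x $ k})"
    by (auto simp: less_eq_vec_def)
  have closed_orth: "closed {x :: real ^ 'm. 0 \<le> x}"
    unfolding orth by (intro closed_INT ballI closed_Collect_le continuous_intros)
  have "convex H"
    unfolding H_def
  proof (rule convexI, clarsimp)
    fix x y :: "real ^ 'm" and r r' \<alpha> \<beta> :: real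
    assume *: "0 \<le> x" "r \<le> u x" "0 \<le> y" "r' \<le> u y" "0 \<le> \<alpha>" "0 \<le> \<beta>" "\<alpha> + \<beta> = 1"
    then have "\<alpha> * u x + \<beta> * u y \<le> u (\<alpha> *\<^sub>R x + \<beta> *\<^sub>R y)"
      using conc unfolding concave_on_iff by blast
    moreover have "\<alpha> * r \<le> \<alpha> * u x" "\<beta> * r' \<le> \<beta> * u y"
      using * by (auto intro: mult_left_mono)
    moreover have "0 \<le> \<alpha> *\<^sub>R x + \<beta> *\<^sub>R y"
      using * by (simp add: less_eq_vec_def)
    ultimately show "0 \<le> \<alpha> *\<^sub>R x + \<beta> *\<^sub>R y \<and> \<alpha> * r + \<beta> * r' \<le> u (\<alpha> *\<^sub>R x + \<beta> *\<^sub>R y)"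
      by linarith
  qed
  moreover have "closed H"
  proof -
    have "closed {z \<in> {x. 0 \<le> x} \<times> UNIV. snd z \<le> u (fst z)}"
      by (intro continuous_on_closed_Collect_le)
         (auto intro!: closed_Times closed_orth continuous_intros continuous_on_compose2[OF cont])
    moreover have "{z \<in> {x. 0 \<le> x} \<times> UNIV. snd z \<le> u (fst z)} = H" by (auto simp: H_def)
    ultimately show ?thesis by simp
  qed
  moreover have "(x0, c) \<notin> H" using assms by (auto simp: H_def)
  ultimately obtain q d where q: "inner q (x0, c) < d" "\<And>z. z \<in> H \<Longrightarrow> d < inner q z"
    using separating_hyperplane_closed_point[of H "(x0, c)"] by blast
  obtain p e where [simp]: "q = (p, e)" by (cases q)
  have q1: "inner p x0 + e * c < d" using q(1) by (simp add: inner_prod_def)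
  have q2: "d < inner p x + e * u x" if "0 \<le> x" for x
    using q(2)[of "(x, u x)"] that by (simp add: H_def inner_prod_def)
  \<comment> \<open>The hyperplane is not vertical: \<open>(x0, u x0)\<close> and
    \<open>(x0, c)\<close> lie on different sides of it.\<close>
  have "e * c < e * u x0" using q1 q2[OF \<open>0 \<le> x0\<close>] by linarith
  then have e: "e < 0" using \<open>u x0 < c\<close> by (simp add: mult_less_cancel_left)
  show thesis
  proof (rule that[of "(1 / (-e)) *\<^sub>R p" "- d / (-e)"])
    show "u x \<le> inner ((1 / - e) *\<^sub>R p) x + - d / - e" if "0 \<le> x" for x
      using q2[OF that] e by (simp add: field_simps)
    show "inner ((1 / - e) *\<^sub>R p) x0 + - d / - e < c"
      using q1 e by (simp add: field_simps)
  qed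
qed

text \<open>Rounding all coefficients up preserves the majorant, since bundles are nonnegative; the
  rounding only has to be fine enough at \<open>x0\<close>.\<close>

lemma concave_on_orthant_rat_majorant:
  fixes u :: "real ^ 'm::finite \<Rightarrow> real"
  assumes conc: "concave_on {x. 0 \<le> x} u" and cont: "continuous_on {x. 0 \<le> x} u"
    and x0: "0 \<le> x0" and "u x0 < c"
  obtains f :: "'m \<Rightarrow> rat" and r :: rat
  where "\<And>x. 0 \<le> x \<Longrightarrow> u x \<le> (\<Sum>k\<in>UNIV. of_rat (f k) * x $ k) + of_rat r"
    "(\<Sum>k\<in>UNIV. of_rat (f k) * x0 $ k) + of_rat r < c"
proof -
  obtain a b where ab: "\<And>x. 0 \<le> x \<Longrightarrow> u x \<le> inner a x + b" "inner a x0 + b < c"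
    using concave_on_orthant_majorant[OF assms] by blast
  \<comment> \<open>Half of the gap below \<open>c\<close> pays for rounding the slopes and half for
    rounding the constant; the 1 in \<open>D\<close> keeps it positive when \<open>x0\<close> is
    0.\<close>
  define \<eta> where "\<eta> = (c - (inner a x0 + b)) / 2"
  define D where "D = 1 + (\<Sum>k\<in>UNIV. x0 $ k)"
  have x0k: "0 \<le> x0 $ k" for k using x0 by (simp add: less_eq_vec_def)
  have \<eta>: "0 < \<eta>" using ab(2) by (simp add: \<eta>_def)
  have D: "0 < D" using sum_nonneg[of UNIV "\<lambda>k. x0 $ k"] x0k by (simp add: D_def)
  have "\<exists>q. a $ k < real_of_rat q \<and> real_of_rat q < a $ k + \<eta> / D" for k
    using \<eta> D by (intro of_rat_dense) simp
  then obtain f where f: "\<And>k. a $ k < real_of_rat (f k)" "\<And>k. real_of_rat (f k) < a $ k + \<eta> / D"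
    by metis
  obtain r where r: "b < real_of_rat r" "real_of_rat r < b + \<eta>"
    using of_rat_dense[of b "b + \<eta>"] \<eta> by auto
  show thesis
  proof (rule that)
    fix x :: "real ^ 'm" assume x: "0 \<le> x"
    have "inner a x \<le> (\<Sum>k\<in>UNIV. of_rat (f k) * x $ k)"
      unfolding inner_vec_def using f(1) x
      by (intro sum_mono) (simp add: less_eq_vec_def mult_right_mono less_imp_le del: mult_le_cancel_right)
    with ab(1)[OF x] r(1) show "u x \<le> (\<Sum>k\<in>UNIV. of_rat (f k) * x $ k) + of_rat r" by linarith
  next
    have "(\<Sum>k\<in>UNIV. of_rat (f k) * x0 $ k) \<le> (\<Sum>k\<in>UNIV. a $ k * x0 $ k + \<eta> / D * x0 $ k)"
      unfolding distrib_right[symmetric]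
      by (intro sum_mono mult_right_mono less_imp_le f(2) x0k)
    also have "\<dots> = inner a x0 + \<eta> * ((\<Sum>k\<in>UNIV. x0 $ k) / D)"
      by (simp add: inner_vec_def sum.distrib sum_distrib_left sum_divide_distrib)
    also have "\<eta> * ((\<Sum>k\<in>UNIV. x0 $ k) / D) \<le> \<eta> * 1"
      using \<eta> D by (intro mult_left_mono) (auto simp: D_def field_simps)
    finally show "(\<Sum>k\<in>UNIV. of_rat (f k) * x0 $ k) + of_rat r < c"
      using r(2) by (simp add: \<eta>_def field_simps)
  qed
qed

lemma rat_dense_orthant:
  fixes x :: "real ^ 'm::finite"
  assumes "0 \<le> x"
  obtains g :: "nat \<Rightarrow> 'm \<Rightarrow> rat" where "\<And>n k. 0 \<le> g n k"
    "(\<lambda>n. \<chi> k. real_of_rat (g n k)) \<longlonglongrightarrow> x"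
proof -
  define g where "g n k = (SOME q. x $ k < real_of_rat q \<and> real_of_rat q < x $ k + 1 / real (Suc n))" for n k
  have "x $ k < real_of_rat (g n k) \<and> real_of_rat (g n k) < x $ k + 1 / real (Suc n)" for n k
    unfolding g_def by (rule someI_ex, rule of_rat_dense) simp
  then have g: "x $ k < real_of_rat (g n k)" "real_of_rat (g n k) < x $ k + 1 / real (Suc n)" for n k
    by blast+
  show thesis
  proof (rule that)
    have "0 \<le> x $ k" for k using assms by (simp add: less_eq_vec_def)
    then have "0 < real_of_rat (g n k)" for n k using g(1) le_less_trans by blast
    then show "0 \<le> g n k" for n k by (simp add: less_imp_le)
    show "(\<lambda>n. \<chi> k. real_of_rat (g n k)) \<longlonglongrightarrow> x"
    proof (rule vec_tendstoI)
      fix k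
      have u: "(\<lambda>n. x $ k + 1 / real (Suc n)) \<longlonglongrightarrow> x $ k"
        using tendsto_add[OF tendsto_const LIMSEQ_Suc[OF lim_1_over_n], of "x $ k"] by simp
      show "(\<lambda>n. (\<chi> k. real_of_rat (g n k)) $ k) \<longlonglongrightarrow> x $ k"
        unfolding vec_lambda_beta
        by (rule tendsto_sandwich[OF _ _ tendsto_const u])
           (rule always_eventually, rule allI, rule less_imp_le, rule g)+
    qed
  qed
qed

text \<open>A concave function on the orthant is the infimum of its affine majorants with rational
  coefficients, so only countably many null sets arise.\<close>

lemma (in finite_measure_subalgebra) real_cond_exp_jensen_orthant:
  fixes v :: "'a \<Rightarrow> real ^ 'm::finite \<Rightarrow> real" and X Y :: "'a \<Rightarrow> real ^ 'm"
  assumes meas: "\<And>x. 0 \<le> x \<Longrightarrow> (\<lambda>p. v p x) \<in> borel_measurable F"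
    and cont: "\<And>p. p \<in> space M \<Longrightarrow> continuous_on {x. 0 \<le> x} (v p)"
    and conc: "\<And>p. p \<in> space M \<Longrightarrow> concave_on {x. 0 \<le> x} (v p)"
    and X: "integrable M X" "\<And>p. p \<in> space M \<Longrightarrow> 0 \<le> X p"
    and Y: "\<And>p. p \<in> space M \<Longrightarrow> 0 \<le> Y p"
      "\<And>k. AE p in M. Y p $ k = real_cond_exp M F (\<lambda>p. X p $ k) p"
    and vX: "integrable M (\<lambda>p. v p (X p))"
  shows "AE p in M. real_cond_exp M F (\<lambda>p. v p (X p)) p \<le> v p (Y p)"
proof -
  define aff where "aff f r x = (\<Sum>k\<in>UNIV. real_of_rat (f k) * x $ k) + real_of_rat r"
    for f :: "'m \<Rightarrow> rat" and r and x :: "real ^ 'm"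
  \<comment> \<open>The inequality is tested at rational bundles only, which makes
    \<open>S f r\<close> a countable intersection of sets in \<open>F\<close>; by continuity it then
    holds on the whole orthant.\<close>
  define S where "S f r = {p \<in> space M. \<forall>g. (\<forall>k. 0 \<le> g k) \<longrightarrow>
      v p (\<chi> k. real_of_rat (g k)) \<le> aff f r (\<chi> k. real_of_rat (g k))}" for f r
  have spF: "space F = space M" using subalg by (simp add: subalgebra_def)
  have S: "p \<in> S f r \<longleftrightarrow> (\<forall>x\<ge>0. v p x \<le> aff f r x)" if p: "p \<in> space M" for p f r
  proof safe
    fix x :: "real ^ 'm" assume pS: "p \<in> S f r" and x: "0 \<le> x"
    obtain g :: "nat \<Rightarrow> 'm \<Rightarrow> rat" where g: "\<And>n k. 0 \<le> g n k" "(\<lambda>n. \<chi> k. real_of_rat (g n k)) \<longlonglongrightarrow> x"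
      using rat_dense_orthant[OF x] by blast
    have nn: "\<forall>n. (\<chi> k. real_of_rat (g n k)) \<in> {x. 0 \<le> x}"
      using g(1) by (auto simp: less_eq_vec_def)
    have "(\<lambda>n. v p (\<chi> k. real_of_rat (g n k))) \<longlonglongrightarrow> v p x"
      by (rule continuous_on_tendsto_compose[OF cont[OF p] g(2)]) (use nn x in simp_all)
    moreover have "(\<lambda>n. aff f r (\<chi> k. real_of_rat (g n k))) \<longlonglongrightarrow> aff f r x"
      unfolding aff_def by (intro tendsto_intros g(2))
    ultimately show "v p x \<le> aff f r x"
      by (rule LIMSEQ_le) (use pS g(1) in \<open>auto simp: S_def\<close>)
  qed (use p in \<open>auto simp: S_def less_eq_vec_def\<close>)
  have S_sets[measurable]: "S f r \<in> sets F" for f r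
  proof -
    have "S f r = {p \<in> space F. \<forall>g. (\<forall>k. 0 \<le> g k) \<longrightarrow>
      v p (\<chi> k. real_of_rat (g k)) \<le> aff f r (\<chi> k. real_of_rat (g k))}" by (simp add: S_def spF)
    moreover have "Measurable.pred F (\<lambda>p. (\<forall>k. 0 \<le> g k) \<longrightarrow>
      v p (\<chi> k. real_of_rat (g k)) \<le> aff f r (\<chi> k. real_of_rat (g k)))" for g :: "'m \<Rightarrow> rat"
    proof (cases "\<forall>k. 0 \<le> g k")
      case True
      then have [measurable]: "(\<lambda>p. v p (\<chi> k. real_of_rat (g k))) \<in> borel_measurable F"
        by (intro meas) (simp add: less_eq_vec_def)
      show ?thesis by measurable
    next
      case False
      then have "(\<lambda>p. (\<forall>k. 0 \<le> g k) \<longrightarrow>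
        v p (\<chi> k. real_of_rat (g k)) \<le> aff f r (\<chi> k. real_of_rat (g k))) = (\<lambda>_. True)" by blast
      then show ?thesis by (simp only: measurable_const) simp
    qed
    ultimately show ?thesis by simp
  qed
  have Xk: "integrable M (\<lambda>p. X p $ k)" for k using X(1) integrable_vec_iff by blast
  have aff_int: "integrable M (\<lambda>p. aff f r (X p))" for f r
    unfolding aff_def by (intro Bochner_Integration.integrable_add Bochner_Integration.integrable_sum
      integrable_mult_right Xk integrable_const)
  have ce_aff: "AE p in M. real_cond_exp M F (\<lambda>p. aff f r (X p)) p = aff f r (Y p)" for f r
  proof -
    have 1: "AE p in M. real_cond_exp M F (\<lambda>p. (\<Sum>k\<in>UNIV. real_of_rat (f k) * X p $ k) + real_of_rat r) p
      = real_cond_exp M F (\<lambda>p. \<Sum>k\<in>UNIV. real_of_rat (f k) * X p $ k) p + real_cond_exp M F (\<lambda>p. real_of_rat r) p"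
      by (intro real_cond_exp_add Bochner_Integration.integrable_sum integrable_mult_right Xk integrable_const)
    have 2: "AE p in M. real_cond_exp M F (\<lambda>p. real_of_rat r) p = real_of_rat r"
      by (intro real_cond_exp_F_meas) auto
    have 3: "AE p in M. real_cond_exp M F (\<lambda>p. \<Sum>k\<in>UNIV. real_of_rat (f k) * X p $ k) p
       = (\<Sum>k\<in>UNIV. real_cond_exp M F (\<lambda>p. real_of_rat (f k) * X p $ k) p)"
      by (intro real_cond_exp_sum integrable_mult_right Xk)
    have 4: "AE p in M. \<forall>k. real_cond_exp M F (\<lambda>p. real_of_rat (f k) * X p $ k) p
       = real_of_rat (f k) * real_cond_exp M F (\<lambda>p. X p $ k) p"
      unfolding AE_all_countable by (intro allI real_cond_exp_cmult Xk)
    have 5: "AE p in M. \<forall>k. Y p $ k = real_cond_exp M F (\<lambda>p. X p $ k) p"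
      unfolding AE_all_countable by (intro allI Y(2))
    from 1 2 3 4 5 show ?thesis unfolding aff_def by eventually_elim simp
  qed
  \<comment> \<open>An affine majorant valid at one \<open>p\<close> need not be valid at another.
    As \<open>S f r\<close> belongs to \<open>F\<close>, multiplying by its indicator commutes with
    conditional expectation and restricts the comparison to the points where the majorant is
    valid.\<close>
  have le: "AE p in M. p \<in> S f r \<longrightarrow> real_cond_exp M F (\<lambda>p. v p (X p)) p \<le> aff f r (Y p)" for f r
  proof -
    have SM: "S f r \<in> sets M" using S_sets subalg by (auto simp: subalgebra_def)
    have i1: "integrable M (\<lambda>p. indicat_real (S f r) p * v p (X p))"
      using integrable_mult_indicator[OF SM vX] by simp
    have i2: "integrable M (\<lambda>p. indicat_real (S f r) p * aff f r (X p))"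
      using integrable_mult_indicator[OF SM aff_int] by simp
    have "indicat_real (S f r) p * v p (X p) \<le> indicat_real (S f r) p * aff f r (X p)" if "p \<in> space M" for p
      using S[OF that] X(2)[OF that] by (auto simp: indicator_def)
    then have 1: "AE p in M. real_cond_exp M F (\<lambda>p. indicat_real (S f r) p * v p (X p)) p
        \<le> real_cond_exp M F (\<lambda>p. indicat_real (S f r) p * aff f r (X p)) p"
      by (intro real_cond_exp_mono i1 i2 AE_I2)
    have 2: "AE p in M. real_cond_exp M F (\<lambda>p. indicat_real (S f r) p * v p (X p)) p
        = indicat_real (S f r) p * real_cond_exp M F (\<lambda>p. v p (X p)) p"
      by (intro real_cond_exp_mult i1 borel_measurable_integrable[OF vX]) measurable
    have 3: "AE p in M. real_cond_exp M F (\<lambda>p. indicat_real (S f r) p * aff f r (X p)) p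
        = indicat_real (S f r) p * real_cond_exp M F (\<lambda>p. aff f r (X p)) p"
      by (intro real_cond_exp_mult i2 borel_measurable_integrable[OF aff_int]) measurable
    from 1 2 3 ce_aff[of f r] show ?thesis by eventually_elim (auto simp: indicator_def)
  qed
  have "AE p in M. \<forall>f r. p \<in> S f r \<longrightarrow> real_cond_exp M F (\<lambda>p. v p (X p)) p \<le> aff f r (Y p)"
    unfolding AE_all_countable by (intro allI le)
  then show ?thesis
  proof (rule AE_mp, intro AE_I2 impI)
    fix p assume p: "p \<in> space M"
      and le: "\<forall>f r. p \<in> S f r \<longrightarrow> real_cond_exp M F (\<lambda>p. v p (X p)) p \<le> aff f r (Y p)"
    show "real_cond_exp M F (\<lambda>p. v p (X p)) p \<le> v p (Y p)"
    proof (rule ccontr)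
      assume "\<not> ?thesis"
      then have "v p (Y p) < real_cond_exp M F (\<lambda>p. v p (X p)) p" by simp
      then obtain f r where "\<And>x. 0 \<le> x \<Longrightarrow> v p x \<le> aff f r x"
          "aff f r (Y p) < real_cond_exp M F (\<lambda>p. v p (X p)) p"
        unfolding aff_def by (rule concave_on_orthant_rat_majorant[OF conc[OF p] cont[OF p] Y(1)[OF p]]) blast
      with le S[OF p] show False by fastforce
    qed
  qed
qed


section \<open>Generated sub-\<open>\<sigma>\<close>-algebras\<close>

lemma subalgebra_gen_sub_algebra:
  assumes "X \<in> measurable M N"
  shows "subalgebra M (gen_sub_algebra M N X)"
proof -
  have sub: "{X -` A \<inter> space M | A. A \<in> sets N} \<union> null_sets M \<subseteq> sets M"
    using assms by (auto intro: measurable_sets)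
  then have "sigma_sets (space M) ({X -` A \<inter> space M | A. A \<in> sets N} \<union> null_sets M) \<subseteq> sets M"
    by (rule sets.sigma_sets_subset)
  moreover have "{X -` A \<inter> space M | A. A \<in> sets N} \<union> null_sets M \<subseteq> Pow (space M)"
    using sub sets.sets_into_space by blast
  ultimately show ?thesis
    by (simp add: subalgebra_def gen_sub_algebra_def sets_measure_of space_measure_of)
qed

lemma vimage_in_gen_sub_algebra:
  assumes "A \<in> sets N"
  shows "X -` A \<inter> space M \<in> sets (gen_sub_algebra M N X)"
proof -
  have "{X -` A \<inter> space M | A. A \<in> sets N} \<union> null_sets M \<subseteq> Pow (space M)"
    using sets.sets_into_space by blast
  then show ?thesis using assms by (auto simp: gen_sub_algebra_def)
qed

text \<open>Agreeing almost surely with a preimage is a property that null sets have, via the empty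
  set, and that complements and countable unions inherit. \<open>B\<close> is an arbitrary set, with
  no claim of measurability.\<close>

lemma gen_sub_algebra_AE_vimage:
  assumes "A \<in> sets (gen_sub_algebra M N X)"
  shows "\<exists>B. AE \<omega> in M. \<omega> \<in> A \<longleftrightarrow> X \<omega> \<in> B"
proof -
  have "{X -` A \<inter> space M | A. A \<in> sets N} \<union> null_sets M \<subseteq> Pow (space M)"
    using sets.sets_into_space by blast
  then have "A \<in> sigma_sets (space M) ({X -` A \<inter> space M | A. A \<in> sets N} \<union> null_sets M)"
    using assms by (simp add: gen_sub_algebra_def)
  then show ?thesis
  proof induction
    case (Basic a)
    then consider C where "a = X -` C \<inter> space M" | "a \<in> null_sets M" by blast
    then show ?case
    proof cases
      case 1
      then show ?thesis by (intro exI[of _ C]) auto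
    next
      case 2
      then show ?thesis using AE_not_in[OF 2] by (intro exI[of _ "{}"]) auto
    qed
  next
    case Empty
    show ?case by (intro exI[of _ "{}"]) auto
  next
    case (Compl a)
    then obtain B where "AE \<omega> in M. \<omega> \<in> a \<longleftrightarrow> X \<omega> \<in> B" by blast
    then show ?case by (intro exI[of _ "- B"]) auto
  next
    case (Union a)
    then obtain B where "\<And>i. AE \<omega> in M. \<omega> \<in> a i \<longleftrightarrow> X \<omega> \<in> B i" by metis
    then have "AE \<omega> in M. \<forall>i :: nat. \<omega> \<in> a i \<longleftrightarrow> X \<omega> \<in> B i" by (simp add: AE_all_countable)
    then show ?case by (intro exI[of _ "\<Union>i. B i"]) (auto elim: eventually_mono)
  qed
qed

text \<open>A factorization in the style of Doob and Dynkin. Off one null set, \<open>X\<close>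
  decides membership of \<open>s\<close> in each of countably many basic open sets, and in a
  Hausdorff space these memberships determine the point. The factor is obtained by choice, so it
  comes without measurability.\<close>

lemma gen_sub_algebra_AE_factor:
  fixes s :: "'a \<Rightarrow> 's::{second_countable_topology, t2_space}"
  assumes "\<And>U. open U \<Longrightarrow> s -` U \<inter> space M \<in> sets (gen_sub_algebra M N X)"
  obtains \<theta> where "AE \<omega> in M. \<theta> (X \<omega>) = s \<omega>"
proof -
  obtain \<B> :: "'s set set" where \<B>: "countable \<B>" "topological_basis \<B>"
    using ex_countable_basis by auto
  have "\<forall>U\<in>\<B>. \<exists>B. AE \<omega> in M. \<omega> \<in> s -` U \<inter> space M \<longleftrightarrow> X \<omega> \<in> B"
    by (intro ballI gen_sub_algebra_AE_vimage[where N=N] assms topological_basis_open[OF \<B>(2)])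
  then obtain B where B: "\<And>U. U \<in> \<B> \<Longrightarrow> AE \<omega> in M. \<omega> \<in> s -` U \<inter> space M \<longleftrightarrow> X \<omega> \<in> B U"
    by metis
  define G where "G \<omega> \<longleftrightarrow> (\<forall>U\<in>\<B>. s \<omega> \<in> U \<longleftrightarrow> X \<omega> \<in> B U)" for \<omega>
  have "AE \<omega> in M. \<forall>U\<in>\<B>. \<omega> \<in> s -` U \<inter> space M \<longleftrightarrow> X \<omega> \<in> B U"
    using \<B>(1) B by (simp add: AE_ball_countable)
  with AE_space have G: "AE \<omega> in M. G \<omega>" by eventually_elim (auto simp: G_def)
  have inj: "s \<omega> = s \<omega>'" if "G \<omega>" "G \<omega>'" "X \<omega> = X \<omega>'" for \<omega> \<omega>'
  proof (rule ccontr)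
    assume "s \<omega> \<noteq> s \<omega>'"
    then obtain U V where "open U" "open V" "s \<omega> \<in> U" "s \<omega>' \<in> V" "U \<inter> V = {}"
      by (rule hausdorff[elim_format]) blast
    then obtain W where "W \<in> \<B>" "s \<omega> \<in> W" "W \<subseteq> U" "s \<omega>' \<notin> W"
      using topological_basisE[OF \<B>(2), of U "s \<omega>"] by blast
    with that show False by (auto simp: G_def)
  qed
  show thesis
  proof (rule that)
    \<comment> \<open>\<open>\<theta>\<close> sends a value to the image under \<open>s\<close> of
      some good point where \<open>X\<close> takes this value; by \<open>inj\<close> it does not
      matter which point is chosen.\<close>
    from G show "AE \<omega> in M. s (SOME \<omega>'. G \<omega>' \<and> X \<omega>' = X \<omega>) = s \<omega>"
    proof eventually_elim
      case (elim \<omega>)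
      have "G (SOME \<omega>'. G \<omega>' \<and> X \<omega>' = X \<omega>) \<and> X (SOME \<omega>'. G \<omega>' \<and> X \<omega>' = X \<omega>) = X \<omega>"
        using elim by (intro someI_ex[where P="\<lambda>\<omega>'. G \<omega>' \<and> X \<omega>' = X \<omega>"]) auto
      with inj elim show ?case by blast
    qed
  qed
qed


section \<open>Fubini extensions and the exact law of large numbers\<close>

text \<open>Completeness turns agreement almost everywhere into measurability. This serves functions
  that involve choices or section integrals, whose measurability is not visible from their
  definition.\<close>

lemma (in complete_measure) measurable_AE_cong:
  assumes f: "f \<in> measurable M L" and eq: "AE x in M. f x = g x"
    and sp: "\<And>x. x \<in> space M \<Longrightarrow> g x \<in> space L"
  shows "g \<in> measurable M L"
proof (rule measurableI[OF sp])
  fix A assume "A \<in> sets L"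
  with f have A: "f -` A \<inter> space M \<in> sets M" by (rule measurable_sets)
  have "AE x in M. x \<in> f -` A \<inter> space M \<longleftrightarrow> x \<in> g -` A \<inter> space M"
    using eq by eventually_elim simp
  then show "g -` A \<inter> space M \<in> sets M" using A by (rule in_sets_AE) auto
qed

lemma (in prob_space) integral_unit_interval:
  assumes "\<And>x. x \<in> space M \<Longrightarrow> 0 \<le> f x \<and> f x \<le> (1 :: real)"
  shows "0 \<le> (\<integral>x. f x \<partial>M)" "(\<integral>x. f x \<partial>M) \<le> 1"
proof -
  show "0 \<le> (\<integral>x. f x \<partial>M)" using assms by (intro integral_nonneg_AE AE_I2) auto
  show "(\<integral>x. f x \<partial>M) \<le> 1"
    using assms by (cases "integrable M f") (auto intro!: integral_le_const AE_I2 simp: not_integrable_integral_eq)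
qed

section \<open>Fubini extensions: marginals, null sets and sections\<close>

locale fubini_ext = M: prob_space M + N: prob_space N + N: complete_measure N
  for M :: "'a measure" and N :: "'b measure" +
  fixes Q :: "('a \<times> 'b) measure"
  assumes ext: "fubini_extension M N Q"
begin

sublocale Q: prob_space Q
  using ext by (simp add: fubini_extension_def)

sublocale Q: complete_measure Q
  using ext by (simp add: fubini_extension_def)

lemma space_Q: "space Q = space M \<times> space N"
  and sets_pair_subset: "sets (M \<Otimes>\<^sub>M N) \<subseteq> sets Q"
  and emeasure_Q_pair: "A \<in> sets (M \<Otimes>\<^sub>M N) \<Longrightarrow> emeasure Q A = emeasure (M \<Otimes>\<^sub>M N) A"
  using ext by (auto simp: fubini_extension_def)

lemma
  fixes h :: "'a \<times> 'b \<Rightarrow> real"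
  assumes "integrable Q h"
  shows AE_integrable_fst: "AE i in M. integrable N (\<lambda>\<omega>. h (i, \<omega>))"
    and AE_integrable_snd: "AE \<omega> in N. integrable M (\<lambda>i. h (i, \<omega>))"
    and integrable_fst: "integrable M (\<lambda>i. \<integral>\<omega>. h (i, \<omega>) \<partial>N)"
    and integrable_snd: "integrable N (\<lambda>\<omega>. \<integral>i. h (i, \<omega>) \<partial>M)"
    and integral_fst: "(\<integral>p. h p \<partial>Q) = (\<integral>i. (\<integral>\<omega>. h (i, \<omega>) \<partial>N) \<partial>M)"
    and integral_snd: "(\<integral>p. h p \<partial>Q) = (\<integral>\<omega>. (\<integral>i. h (i, \<omega>) \<partial>M) \<partial>N)"
  using ext assms unfolding fubini_extension_def by blast+

lemma measurable_from_pair: "f \<in> measurable (M \<Otimes>\<^sub>M N) L \<Longrightarrow> f \<in> measurable Q L"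
  using sets_pair_subset by (auto simp: measurable_def space_Q space_pair_measure)

lemma measurable_fst_Q[measurable]: "fst \<in> measurable Q M"
  and measurable_snd_Q[measurable]: "snd \<in> measurable Q N"
  by (auto intro: measurable_from_pair)

lemma distr_snd_Q: "distr Q N snd = N"
proof (rule measure_eqI)
  fix A assume "A \<in> sets (distr Q N snd)"
  then have A: "A \<in> sets N" by simp
  have "snd -` A \<inter> space Q = space M \<times> A" using sets.sets_into_space[OF A] by (auto simp: space_Q)
  then show "emeasure (distr Q N snd) A = emeasure N A"
    using A by (simp add: emeasure_distr emeasure_Q_pair N.emeasure_pair_measure_Times M.emeasure_space_1)
qed simp

lemma AE_Q_snd: "(AE \<omega> in N. R \<omega>) \<Longrightarrow> AE p in Q. R (snd p)"
  using AE_distrD[OF measurable_snd_Q, of R] unfolding distr_snd_Q .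

lemma integrable_Q_snd:
  fixes f :: "'b \<Rightarrow> 'c::{banach, second_countable_topology}"
  shows "integrable N f \<Longrightarrow> integrable Q (\<lambda>p. f (snd p))"
  by (rule integrable_distr[OF measurable_snd_Q]) (simp add: distr_snd_Q)

text \<open>The exceptional set is enclosed in a measurable null set, to whose indicator the Fubini
  property applies: the section measures integrate to 0, hence vanish for almost all
  \<open>i\<close>.\<close>

lemma AE_AE_fst:
  assumes "AE p in Q. R p"
  shows "AE i in M. AE \<omega> in N. R (i, \<omega>)"
proof -
  obtain Z where Z: "{p \<in> space Q. \<not> R p} \<subseteq> Z" "Z \<in> sets Q" "emeasure Q Z = 0"
    by (rule AE_E[OF assms]) auto
  have int: "integrable Q (indicat_real Z)" using Z by (simp add: integrable_indicator_iff)
  have 0: "(\<integral>p. indicat_real Z p \<partial>Q) = 0" using Z by (simp add: measure_def)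
  have "AE i in M. (\<integral>\<omega>. indicat_real Z (i, \<omega>) \<partial>N) = 0"
    using integral_fst[OF int] 0
    by (intro integral_nonneg_eq_0_iff_AE[THEN iffD1] integrable_fst[OF int]) auto
  with AE_integrable_fst[OF int] AE_space show "AE i in M. AE \<omega> in N. R (i, \<omega>)"
  proof eventually_elim
    case (elim i)
    then have "AE \<omega> in N. indicat_real Z (i, \<omega>) = 0"
      by (subst (asm) integral_nonneg_eq_0_iff_AE) auto
    with AE_space show ?case
      by eventually_elim (use Z(1) elim in \<open>auto simp: space_Q split: split_indicator_asm\<close>)
  qed
qed

lemma
  fixes h :: "'a \<times> 'b \<Rightarrow> real ^ 'm::finite"
  assumes h: "integrable Q h"
  shows AE_integrable_snd_vec: "AE \<omega> in N. integrable M (\<lambda>i. h (i, \<omega>))"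
    and integrable_snd_vec: "integrable N (\<lambda>\<omega>. \<integral>i. h (i, \<omega>) \<partial>M)"
proof -
  have hk: "integrable Q (\<lambda>p. h p $ k)" for k using h integrable_vec_iff by blast
  show *: "AE \<omega> in N. integrable M (\<lambda>i. h (i, \<omega>))"
    unfolding integrable_vec_iff AE_all_countable by (intro allI AE_integrable_snd[OF hk])
  show "integrable N (\<lambda>\<omega>. \<integral>i. h (i, \<omega>) \<partial>M)"
    unfolding integrable_vec_iff
  proof
    fix k
    \<comment> \<open>Where the section is not integrable the vector integral is 0 by convention,
      while single coordinate integrals may differ from 0; so the two sides agree only almost
      surely, and completeness of \<open>N\<close> gives measurability.\<close>
    have eq: "AE \<omega> in N. (\<integral>i. h (i, \<omega>) $ k \<partial>M) = (\<integral>i. h (i, \<omega>) \<partial>M) $ k"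
      using * by eventually_elim (simp add: integral_vec_nth)
    show "integrable N (\<lambda>\<omega>. (\<integral>i. h (i, \<omega>) \<partial>M) $ k)"
    proof (rule integrable_cong_AE_imp[OF integrable_snd[OF hk[of k]]])
      show "(\<lambda>\<omega>. (\<integral>i. h (i, \<omega>) \<partial>M) $ k) \<in> borel_measurable N"
        by (rule N.measurable_AE_cong[OF borel_measurable_integrable[OF integrable_snd[OF hk]] eq]) simp
      show "AE \<omega> in N. (\<integral>i. h (i, \<omega>) $ k \<partial>M) = (\<integral>i. h (i, \<omega>) \<partial>M) $ k"
        by (rule eq)
    qed
  qed
qed

text \<open>A weight depending on the second coordinate alone leaves the inner integral over the
  first. Equating the last two conclusions exchanges the order of integration for a fixed
  weight.\<close>

lemma integrable_snd_mult:
  assumes a: "integrable N a" and b: "b \<in> borel_measurable Q"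
    and bounds: "\<And>p. p \<in> space Q \<Longrightarrow> 0 \<le> b p \<and> b p \<le> (1 :: real)"
  shows "integrable Q (\<lambda>p. a (snd p) * b p)"
    and "(\<integral>p. a (snd p) * b p \<partial>Q) = (\<integral>i. (\<integral>\<omega>. a \<omega> * b (i, \<omega>) \<partial>N) \<partial>M)"
    and "(\<integral>p. a (snd p) * b p \<partial>Q) = (\<integral>\<omega>. a \<omega> * (\<integral>i. b (i, \<omega>) \<partial>M) \<partial>N)"
proof -
  show int: "integrable Q (\<lambda>p. a (snd p) * b p)"
  proof (rule Bochner_Integration.integrable_bound[OF integrable_Q_snd[OF a]])
    show "AE p in Q. norm (a (snd p) * b p) \<le> norm (a (snd p))"
      using bounds by (intro AE_I2) (auto simp: abs_mult intro!: mult_left_le)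
  qed (use b borel_measurable_integrable[OF integrable_Q_snd[OF a]] in measurable)
  show "(\<integral>p. a (snd p) * b p \<partial>Q) = (\<integral>i. (\<integral>\<omega>. a \<omega> * b (i, \<omega>) \<partial>N) \<partial>M)"
    using integral_fst[OF int] by simp
  show "(\<integral>p. a (snd p) * b p \<partial>Q) = (\<integral>\<omega>. a \<omega> * (\<integral>i. b (i, \<omega>) \<partial>M) \<partial>N)"
    using integral_snd[OF int] by simp
qed

lemma subalgebra_pair:
  assumes "subalgebra N C"
  shows "subalgebra Q (M \<Otimes>\<^sub>M C)"
proof -
  have "sets (M \<Otimes>\<^sub>M C) \<subseteq> sets (M \<Otimes>\<^sub>M N)"
    using assms by (intro sets_pair_in_sets) (auto simp: subalgebra_def)
  with sets_pair_subset assms show ?thesis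
    by (auto simp: subalgebra_def space_pair_measure space_Q)
qed

text \<open>With \<open>G\<close> and \<open>H\<close> denoting the two averages, \<open>H\<close> is the
  conditional expectation of \<open>G\<close>, and applying the Fubini property to
  \<open>g (i, \<omega>) * g (j, \<omega>)\<close> for fixed \<open>i\<close> replaces the Fubini theorem on the triple product, on which
  the integrand need not be measurable.\<close>

lemma exact_law_of_large_numbers:
  fixes g m :: "'a \<times> 'b \<Rightarrow> real"
  assumes C: "subalgebra N C"
    and g[measurable]: "g \<in> borel_measurable Q"
    and gi: "\<And>i. i \<in> space M \<Longrightarrow> (\<lambda>\<omega>. g (i, \<omega>)) \<in> borel_measurable N"
    and g01: "\<And>p. p \<in> space Q \<Longrightarrow> 0 \<le> g p \<and> g p \<le> 1"
    and m: "m \<in> borel_measurable (M \<Otimes>\<^sub>M C)"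
    and m01: "\<And>p. p \<in> space Q \<Longrightarrow> 0 \<le> m p \<and> m p \<le> 1"
    and mg: "AE p in Q. m p = real_cond_exp Q (M \<Otimes>\<^sub>M C) g p"
    and indep: "AE i in M. AE j in M. AE \<omega> in N.
       real_cond_exp N C (\<lambda>\<omega>. g (i, \<omega>) * g (j, \<omega>)) \<omega> =
       real_cond_exp N C (\<lambda>\<omega>. g (i, \<omega>)) \<omega> * real_cond_exp N C (\<lambda>\<omega>. g (j, \<omega>)) \<omega>"
  shows "AE \<omega> in N. (\<integral>i. g (i, \<omega>) \<partial>M) = (\<integral>i. m (i, \<omega>) \<partial>M)"
proof -
  define G where "G \<omega> = (\<integral>i. g (i, \<omega>) \<partial>M)" for \<omega>
  define H where "H \<omega> = (\<integral>i. m (i, \<omega>) \<partial>M)" for \<omega>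
  interpret C: finite_measure_subalgebra N C by standard (rule C)
  interpret MC: finite_measure_subalgebra Q "M \<Otimes>\<^sub>M C" by standard (rule subalgebra_pair[OF C])
  have mQ[measurable]: "m \<in> borel_measurable Q"
    using measurable_from_subalg[OF MC.subalg m] .
  have int_g: "integrable Q g" and int_m: "integrable Q m"
    using g01 m01 by (auto intro!: Q.integrable_const_bound[of _ 1] AE_I2)
  have G: "integrable N G" and H: "integrable N H"
    unfolding G_def H_def by (intro integrable_snd int_g int_m)+
  note [measurable] = borel_measurable_integrable[OF G] borel_measurable_integrable[OF H]
  have G01: "0 \<le> G \<omega> \<and> G \<omega> \<le> 1" and H01: "0 \<le> H \<omega> \<and> H \<omega> \<le> 1" if "\<omega> \<in> space N" for \<omega>
    unfolding G_def H_def using that g01 m01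
    by (auto intro!: M.integral_unit_interval simp: space_Q)
  have HC: "H \<in> borel_measurable C"
    unfolding H_def
    using m by (intro M.borel_measurable_lebesgue_integral) (simp add: measurable_pair_swap_iff[of _ M C] case_prod_beta)
  \<comment> \<open>Lifted to the product space, \<open>\<phi>\<close> is measurable for
    \<open>M \<Otimes>\<^sub>M C\<close>, so \<open>g\<close> may be exchanged for its conditional
    expectation \<open>m\<close> before integrating over the first coordinate.\<close>
  have swap_avg: "(\<integral>\<omega>. \<phi> \<omega> * G \<omega> \<partial>N) = (\<integral>\<omega>. \<phi> \<omega> * H \<omega> \<partial>N)"
    if \<phi>: "integrable N \<phi>" and \<phi>C: "\<phi> \<in> borel_measurable C" for \<phi>
  proof -
    have "(\<lambda>p. \<phi> (snd p)) \<in> borel_measurable (M \<Otimes>\<^sub>M C)"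
      using \<phi>C by measurable
    note ce = MC.real_cond_exp_intg(2)[OF integrable_snd_mult(1)[OF \<phi> g g01] this g]
    have "(\<integral>\<omega>. \<phi> \<omega> * G \<omega> \<partial>N) = (\<integral>p. \<phi> (snd p) * g p \<partial>Q)"
      unfolding G_def using integrable_snd_mult(3)[OF \<phi> g g01] by simp
    also have "\<dots> = (\<integral>p. \<phi> (snd p) * real_cond_exp Q (M \<Otimes>\<^sub>M C) g p \<partial>Q)"
      by (rule ce[symmetric])
    also have "\<dots> = (\<integral>p. \<phi> (snd p) * m p \<partial>Q)"
    proof (rule integral_cong_AE)
      show "AE p in Q. \<phi> (snd p) * real_cond_exp Q (M \<Otimes>\<^sub>M C) g p = \<phi> (snd p) * m p"
        using mg by eventually_elim simp
    qed (use borel_measurable_integrable[OF integrable_Q_snd[OF \<phi>]] in measurable)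
    also have "\<dots> = (\<integral>\<omega>. \<phi> \<omega> * H \<omega> \<partial>N)"
      unfolding H_def using integrable_snd_mult(3)[OF \<phi> mQ m01] by simp
    finally show ?thesis .
  qed
  \<comment> \<open>Let \<open>p\<close> be the conditional expectation of the section of
    \<open>g\<close> at \<open>i\<close>. Conditional independence turns the correlation of the
    sections at \<open>i\<close> and \<open>j\<close> into that of \<open>p\<close> with the section
    at \<open>j\<close>. Averaging over \<open>j\<close> produces \<open>G\<close> against
    \<open>p\<close>, which \<open>swap_avg\<close> changes to \<open>H\<close> against
    \<open>p\<close>; as \<open>H\<close> is measurable for \<open>C\<close>, \<open>p\<close> may
    be replaced by the section at \<open>i\<close> again.\<close>
  have main: "AE i in M. (\<integral>\<omega>. G \<omega> * g (i, \<omega>) \<partial>N) = (\<integral>\<omega>. H \<omega> * g (i, \<omega>) \<partial>N)"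
    using indep AE_space
  proof eventually_elim
    case (elim i)
    define p where "p = real_cond_exp N C (\<lambda>\<omega>. g (i, \<omega>))"
    note gi_meas[measurable] = gi[OF elim(2)]
    have g01': "0 \<le> g (j, \<omega>) \<and> g (j, \<omega>) \<le> 1" if "j \<in> space M" "\<omega> \<in> space N" for j \<omega>
      using that g01 by (simp add: space_Q)
    have gi_int: "integrable N (\<lambda>\<omega>. g (i, \<omega>))"
      using g01' elim(2) by (auto intro!: N.integrable_const_bound[of _ 1] AE_I2)
    have p: "integrable N p" "p \<in> borel_measurable C"
      unfolding p_def using gi_int by (auto intro: C.real_cond_exp_int)
    have gg: "(\<integral>\<omega>. g (i, \<omega>) * g (j, \<omega>) \<partial>N) = (\<integral>\<omega>. p \<omega> * g (j, \<omega>) \<partial>N)"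
      if j: "j \<in> space M" and ind: "AE \<omega> in N. real_cond_exp N C (\<lambda>\<omega>. g (i, \<omega>) * g (j, \<omega>)) \<omega> =
       real_cond_exp N C (\<lambda>\<omega>. g (i, \<omega>)) \<omega> * real_cond_exp N C (\<lambda>\<omega>. g (j, \<omega>)) \<omega>" for j
    proof -
      note [measurable] = gi[OF j]
      have 1: "integrable N (\<lambda>\<omega>. g (i, \<omega>) * g (j, \<omega>))"
        using g01' elim(2) j by (auto intro!: N.integrable_const_bound[of _ 1] AE_I2 mult_le_one simp: abs_mult)
      have 2: "integrable N (\<lambda>\<omega>. p \<omega> * g (j, \<omega>))"
      proof (rule Bochner_Integration.integrable_bound[OF p(1)])
        show "AE \<omega> in N. norm (p \<omega> * g (j, \<omega>)) \<le> norm (p \<omega>)"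
          using g01' j by (intro AE_I2) (auto simp: abs_mult intro!: mult_left_le)
      qed (use borel_measurable_integrable[OF p(1)] in measurable)
      have "(\<integral>\<omega>. g (i, \<omega>) * g (j, \<omega>) \<partial>N) = (\<integral>\<omega>. real_cond_exp N C (\<lambda>\<omega>. g (i, \<omega>) * g (j, \<omega>)) \<omega> \<partial>N)"
        by (rule C.real_cond_exp_int(2)[OF 1, symmetric])
      also have "\<dots> = (\<integral>\<omega>. p \<omega> * real_cond_exp N C (\<lambda>\<omega>. g (j, \<omega>)) \<omega> \<partial>N)"
        using ind borel_measurable_integrable[OF p(1)] by (intro integral_cong_AE) (auto simp: p_def)
      also have "\<dots> = (\<integral>\<omega>. p \<omega> * g (j, \<omega>) \<partial>N)"
        by (rule C.real_cond_exp_intg(2)[OF 2 p(2) gi[OF j]])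
      finally show ?thesis .
    qed
    have 3: "integrable N (\<lambda>\<omega>. H \<omega> * g (i, \<omega>))"
      using g01' H01 elim(2) by (auto intro!: N.integrable_const_bound[of _ 1] AE_I2 mult_le_one simp: abs_mult)
    have "(\<integral>\<omega>. g (i, \<omega>) * G \<omega> \<partial>N) = (\<integral>j. (\<integral>\<omega>. g (i, \<omega>) * g (j, \<omega>) \<partial>N) \<partial>M)"
      unfolding G_def
      using integrable_snd_mult(2)[OF gi_int g g01] integrable_snd_mult(3)[OF gi_int g g01] by simp
    also have "\<dots> = (\<integral>j. (\<integral>\<omega>. p \<omega> * g (j, \<omega>) \<partial>N) \<partial>M)"
    proof (rule integral_cong_AE)
      show "AE j in M. (\<integral>\<omega>. g (i, \<omega>) * g (j, \<omega>) \<partial>N) = (\<integral>\<omega>. p \<omega> * g (j, \<omega>) \<partial>N)"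
        using elim(1) AE_space by eventually_elim (rule gg)
      show "(\<lambda>j. \<integral>\<omega>. g (i, \<omega>) * g (j, \<omega>) \<partial>N) \<in> borel_measurable M"
        using integrable_fst[OF integrable_snd_mult(1)[OF gi_int g g01]] by auto
      show "(\<lambda>j. \<integral>\<omega>. p \<omega> * g (j, \<omega>) \<partial>N) \<in> borel_measurable M"
        using integrable_fst[OF integrable_snd_mult(1)[OF p(1) g g01]] by auto
    qed
    also have "\<dots> = (\<integral>\<omega>. p \<omega> * G \<omega> \<partial>N)"
      unfolding G_def
      using integrable_snd_mult(2)[OF p(1) g g01] integrable_snd_mult(3)[OF p(1) g g01] by simp
    also have "\<dots> = (\<integral>\<omega>. p \<omega> * H \<omega> \<partial>N)" by (rule swap_avg[OF p])
    also have "\<dots> = (\<integral>\<omega>. H \<omega> * p \<omega> \<partial>N)" by (simp add: mult.commute)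
    also have "\<dots> = (\<integral>\<omega>. H \<omega> * g (i, \<omega>) \<partial>N)"
      unfolding p_def by (rule C.real_cond_exp_intg(2)[OF 3 HC gi_meas])
    finally show ?case by (simp add: mult.commute)
  qed
  \<comment> \<open>Averaging \<open>main\<close> over \<open>i\<close> gives equal integrals of
    \<open>G * G\<close> and \<open>H * G\<close>, and \<open>swap_avg\<close> with \<open>H\<close>
    as test function gives equal integrals of \<open>H * G\<close> and \<open>H * H\<close>; so the
    mean square of \<open>G - H\<close> vanishes.\<close>
  have "(\<integral>\<omega>. G \<omega> * G \<omega> \<partial>N) = (\<integral>i. (\<integral>\<omega>. G \<omega> * g (i, \<omega>) \<partial>N) \<partial>M)"
    using integrable_snd_mult(2)[OF G g g01] integrable_snd_mult(3)[OF G g g01] by (simp add: G_def)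
  also have "\<dots> = (\<integral>i. (\<integral>\<omega>. H \<omega> * g (i, \<omega>) \<partial>N) \<partial>M)"
  proof (rule integral_cong_AE[OF _ _ main])
    show "(\<lambda>i. \<integral>\<omega>. G \<omega> * g (i, \<omega>) \<partial>N) \<in> borel_measurable M"
      using integrable_fst[OF integrable_snd_mult(1)[OF G g g01]] by auto
    show "(\<lambda>i. \<integral>\<omega>. H \<omega> * g (i, \<omega>) \<partial>N) \<in> borel_measurable M"
      using integrable_fst[OF integrable_snd_mult(1)[OF H g g01]] by auto
  qed
  also have "\<dots> = (\<integral>\<omega>. H \<omega> * G \<omega> \<partial>N)"
    using integrable_snd_mult(2)[OF H g g01] integrable_snd_mult(3)[OF H g g01] by (simp add: G_def)
  finally have GG: "(\<integral>\<omega>. G \<omega> * G \<omega> \<partial>N) = (\<integral>\<omega>. H \<omega> * G \<omega> \<partial>N)" .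
  have HG: "(\<integral>\<omega>. H \<omega> * G \<omega> \<partial>N) = (\<integral>\<omega>. H \<omega> * H \<omega> \<partial>N)" by (rule swap_avg[OF H HC])
  have int: "integrable N (\<lambda>\<omega>. G \<omega> * G \<omega>)" "integrable N (\<lambda>\<omega>. H \<omega> * G \<omega>)" "integrable N (\<lambda>\<omega>. H \<omega> * H \<omega>)"
    using G01 H01 by (auto intro!: N.integrable_const_bound[of _ 1] AE_I2 mult_le_one simp: abs_mult)
  have sq: "(\<lambda>\<omega>. (G \<omega> - H \<omega>)\<^sup>2) = (\<lambda>\<omega>. G \<omega> * G \<omega> - 2 * (H \<omega> * G \<omega>) + H \<omega> * H \<omega>)"
    by (auto simp: power2_eq_square algebra_simps)
  have "(\<integral>\<omega>. (G \<omega> - H \<omega>)\<^sup>2 \<partial>N) = 0"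
    unfolding sq using int GG HG by simp
  moreover have "integrable N (\<lambda>\<omega>. (G \<omega> - H \<omega>)\<^sup>2)"
    unfolding sq using int by simp
  ultimately have "AE \<omega> in N. (G \<omega> - H \<omega>)\<^sup>2 = 0"
    by (subst (asm) integral_nonneg_eq_0_iff_AE) auto
  then show ?thesis by (simp add: G_def H_def)
qed

end


section \<open>The state as a function of the signal frequencies\<close>

text \<open>It lets the averaged conditional law be rebuilt from its point masses, so that a
  function of this law becomes a function of the frequencies.\<close>

lemma measure_on_finite_eq_point_measure:
  fixes M :: "'q::finite measure"
  assumes "finite_measure M" "sets M = UNIV"
  shows "M = point_measure UNIV (\<lambda>q. ennreal (measure M {q}))"
proof (rule measure_eqI)
  interpret finite_measure M by fact
  show "sets M = sets (point_measure UNIV (\<lambda>q. ennreal (measure M {q})))"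
    using assms(2) by (simp add: sets_point_measure)
  fix A assume "A \<in> sets M"
  have "emeasure M A = (\<Sum>q\<in>A. emeasure M {q})"
    by (rule emeasure_eq_sum_singleton) (auto simp: assms(2))
  also have "\<dots> = (\<Sum>q\<in>A. ennreal (measure M {q}))" by (simp add: emeasure_eq_measure)
  also have "\<dots> = emeasure (point_measure UNIV (\<lambda>q. ennreal (measure M {q}))) A"
    by (simp add: emeasure_point_measure_finite)
  finally show "emeasure M A = emeasure (point_measure UNIV (\<lambda>q. ennreal (measure M {q}))) A" .
qed

sublocale private_information_economy \<subseteq> fubini_ext "agents E" "completed_prob E" "fubini E"
proof -
  interpret J: prob_space "joint E" by (rule joint_prob)
  interpret A: prob_space "agents E" by (rule agents_prob)
  interpret P: prob_space "completed_prob E"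
    unfolding completed_prob_def by (rule J.prob_space_completion)
  interpret P: complete_measure "completed_prob E"
    unfolding completed_prob_def by (rule completion.complete_measure_axioms)
  show "fubini_ext (agents E) (completed_prob E) (fubini E)"
    by standard (rule fubini)
qed

lemma state_proj_eq: "state_proj = fst"
  by (auto simp: state_proj_def)

lemma signal_proj_eq: "signal_proj i = (\<lambda>\<omega>. snd \<omega> i)"
  by (auto simp: signal_proj_def)

context private_information_economy
begin

text \<open>The empirical distribution of a profile, given by its point masses. In contrast to the
  averaged conditional law it is computed from the profile alone.\<close>

definition signal_frequencies :: "('i \<Rightarrow> 'q) \<Rightarrow> 'q \<Rightarrow> real" where
  "signal_frequencies t q = measure (agents E) {i. t i = q}"

lemma space_joint: "space (joint E) = UNIV \<times> space (profiles E)"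
  using sets_eq_imp_space_eq[OF joint_sets] by (simp add: space_pair_measure)

lemma space_P: "space (completed_prob E) = UNIV \<times> space (profiles E)"
  by (simp add: completed_prob_def space_joint)

lemma space_fubini: "space (fubini E) = UNIV \<times> UNIV \<times> space (profiles E)"
  by (simp add: space_Q agents_space space_P)

lemma profiles_nonempty: "space (profiles E) \<noteq> {}"
  using prob_space.not_empty[OF joint_prob] by (simp add: space_joint)

lemma measurable_joint_completed: "f \<in> measurable (joint E) L \<Longrightarrow> f \<in> measurable (completed_prob E) L"
  unfolding completed_prob_def by (rule measurable_completion)

lemma measurable_fst_joint: "fst \<in> measurable (joint E) borel"
  and measurable_snd_joint: "snd \<in> measurable (joint E) (profiles E)"
  unfolding measurable_cong_sets[OF joint_sets refl] by (rule measurable_fst measurable_snd)+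

lemma AE_completed_prob_iff: "(AE \<omega> in completed_prob E. R \<omega>) \<longleftrightarrow> (AE \<omega> in joint E. R \<omega>)"
  unfolding completed_prob_def by (rule AE_completion_iff)

text \<open>Passing from P to its marginal is the delicate direction: the preimage of the
  exceptional profiles is null, but the profiles themselves must be covered by a null set of their
  own sigma-algebra. \<open>AE_distr_snd\<close> provides it.\<close>

lemma AE_prob_T_iff: "(AE t in prob_T E. R t) \<longleftrightarrow> (AE \<omega> in completed_prob E. R (snd \<omega>))"
  unfolding prob_T_def AE_completed_prob_iff
  using AE_distr_snd[OF joint_prob joint_sets] AE_distrD[OF measurable_snd_joint] by blast

lemma signal_in_measurable:
  assumes "t \<in> space (profiles E)"
  shows "t \<in> measurable (agents E) (count_space UNIV)"
  using signal_sections_measurable[of "(undefined, t)"] assms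
  by (simp add: space_joint signal_process_def signal_proj_def)

text \<open>By the product structure some profile has the same restriction as \<open>t\<close> and
  the signal \<open>q\<close> at \<open>i\<close>; it can only be \<open>t(i := q)\<close>.\<close>

lemma profile_upd_in_space:
  assumes "t \<in> space (profiles E)"
  shows "t(i := q) \<in> space (profiles E)"
proof -
  have "(restrict t (- {i}), q) \<in> space (others E i) \<times> UNIV"
    using assms by (simp add: others_space)
  then obtain t' where t': "t' \<in> space (profiles E)" "restrict t (- {i}) = restrict t' (- {i})" "q = t' i"
    unfolding others_image[symmetric] by blast
  have "t(i := q) = t'"
  proof
    fix j
    show "(t(i := q)) j = t' j"
      using t'(3) fun_cong[OF t'(2), of j] by (cases "j = i") auto
  qed
  with t'(1) show ?thesis by simp
qed

text \<open>If two signals exist, \<open>{i}\<close> is measurable as the set where \<open>t\<close> and \<open>t(i := q)\<close> differ.\<close>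

lemma AE_profile_upd:
  assumes t: "t \<in> space (profiles E)"
  shows "AE j in agents E. (t(i := q)) j = t j"
proof (cases "t i = q")
  case True
  then show ?thesis by (simp add: fun_upd_idem)
next
  case False
  have "t -` {t i} \<inter> space (agents E) \<in> sets (agents E)"
    "(t(i := q)) -` {t i} \<inter> space (agents E) \<in> sets (agents E)"
    by (rule measurable_sets[OF signal_in_measurable], use t profile_upd_in_space in auto)+
  then have "t -` {t i} \<inter> space (agents E) - (t(i := q)) -` {t i} \<inter> space (agents E) \<in> sets (agents E)"
    by (rule sets.Diff)
  moreover have "t -` {t i} \<inter> space (agents E) - (t(i := q)) -` {t i} \<inter> space (agents E) = {i}"
    using False by (auto simp: agents_space)
  ultimately have i: "{i} \<in> sets (agents E)" by simp
  have "emeasure (agents E) {i} = 0"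
  proof (rule ccontr)
    assume "emeasure (agents E) {i} \<noteq> 0"
    then obtain B where B: "B \<subseteq> {i}" "0 < emeasure (agents E) B" "emeasure (agents E) B < emeasure (agents E) {i}"
      using agents_atomless i unfolding atomless_def by (metis not_gr_zero)
    then consider "B = {}" | "B = {i}" by blast
    then show False using B by cases auto
  qed
  with i have "{i} \<in> null_sets (agents E)" by (rule null_setsI[rotated])
  then have "AE j in agents E. j \<notin> {i}" by (rule AE_not_in)
  then show ?thesis by eventually_elim simp
qed

text \<open>A change at one agent alters each set of agents with a given signal on a null set only.
  This is an identity at every profile, not an almost sure one, and incentive compatibility rests on
  it.\<close>

lemma signal_frequencies_upd:
  assumes t: "t \<in> space (profiles E)"
  shows "signal_frequencies (t(i := q)) = signal_frequencies t"
proof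
  fix r
  have *: "{j. t j = r} \<in> sets (agents E)" if "t \<in> space (profiles E)" for t
    using measurable_sets[OF signal_in_measurable[OF that], of "{r}"] by (simp add: vimage_def agents_space)
  show "signal_frequencies (t(i := q)) r = signal_frequencies t r"
    unfolding signal_frequencies_def
  proof (rule measure_eq_AE)
    show "AE j in agents E. j \<in> {j. (t(i := q)) j = r} \<longleftrightarrow> j \<in> {j. t j = r}"
      using AE_profile_upd[OF t, of i q] by eventually_elim simp
  qed (intro * t profile_upd_in_space)+
qed

lemma measurable_split_profile:
  "(\<lambda>t. (restrict t (- {i}), t i)) \<in> measurable (profiles E) (others E i \<Otimes>\<^sub>M count_space UNIV)"
proof (subst measurable_cong_sets[OF profiles_sets[of i] refl], rule measurable_vimage_algebra1)
  show "(\<lambda>t. (restrict t (- {i}), t i)) \<in> space (profiles E) \<rightarrow> space (others E i \<Otimes>\<^sub>M count_space UNIV)"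
    using others_image[of i] by (auto simp: space_pair_measure)
qed

lemma measurable_signal_proj: "signal_proj i \<in> measurable (joint E) (count_space UNIV)"
  using measurable_compose[OF measurable_compose[OF measurable_snd_joint measurable_split_profile] measurable_snd]
  by (simp add: signal_proj_eq)

lemma subalgebra_state_algebra: "subalgebra (completed_prob E) (state_algebra E)"
proof -
  have "state_proj \<in> measurable (completed_prob E) borel"
    unfolding state_proj_eq by (rule measurable_joint_completed[OF measurable_fst_joint])
  then show ?thesis unfolding state_algebra_def by (rule subalgebra_gen_sub_algebra)
qed

text \<open>The exact law of large numbers is applied to the indicator of each signal
  \<open>q\<close>, with the mass that \<open>\<mu>\<close> gives to \<open>q\<close> as its
  conditional expectation. Finitely many signals lead to a single null set. The other two
  conclusions allow the bind to be recovered from its point masses.\<close>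

lemma average_signal_distr_eq_frequencies:
  assumes \<mu>: "regular_cond_distr (fubini E) (agents E \<Otimes>\<^sub>M state_algebra E) (count_space UNIV) signal_process \<mu>"
  shows "AE \<omega> in completed_prob E. \<forall>q. measure (Giry_Monad.bind (agents E) (\<lambda>i. \<mu> (i, \<omega>))) {q} =
    signal_frequencies (snd \<omega>) q"
    and "\<omega> \<in> space (completed_prob E) \<Longrightarrow> finite_measure (Giry_Monad.bind (agents E) (\<lambda>i. \<mu> (i, \<omega>)))"
    and "\<omega> \<in> space (completed_prob E) \<Longrightarrow> sets (Giry_Monad.bind (agents E) (\<lambda>i. \<mu> (i, \<omega>))) = UNIV"
proof -
  have spC: "space (state_algebra E) = space (completed_prob E)"
    using subalgebra_state_algebra by (simp add: subalgebra_def)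
  have \<mu>m: "\<mu> \<in> measurable (agents E \<Otimes>\<^sub>M state_algebra E) (prob_algebra (count_space UNIV))"
    and \<mu>ce: "AE p in fubini E. measure (\<mu> p) B =
       real_cond_exp (fubini E) (agents E \<Otimes>\<^sub>M state_algebra E) (indicator (signal_process -` B \<inter> space (fubini E))) p" for B
    using \<mu> by (auto simp: regular_cond_distr_def)
  have \<mu>_prob: "prob_space (\<mu> (i, \<omega>))" if "\<omega> \<in> space (completed_prob E)" for i \<omega>
    using measurable_space[OF \<mu>m, of "(i, \<omega>)"] that
    by (simp add: space_pair_measure agents_space spC space_prob_algebra)
  have \<mu>i: "(\<lambda>i. \<mu> (i, \<omega>)) \<in> measurable (agents E) (prob_algebra (count_space UNIV))"
    if "\<omega> \<in> space (completed_prob E)" for \<omega>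
    using that spC by (intro measurable_compose[OF measurable_Pair2' \<mu>m]) simp
  note \<mu>i' = measurable_prob_algebraD[OF \<mu>i]
  show "finite_measure (Giry_Monad.bind (agents E) (\<lambda>i. \<mu> (i, \<omega>)))" if "\<omega> \<in> space (completed_prob E)" for \<omega>
    using M.prob_space_bind[OF AE_I2 \<mu>i'[OF that]] \<mu>_prob[OF that] by (simp add: prob_space.finite_measure)
  show "sets (Giry_Monad.bind (agents E) (\<lambda>i. \<mu> (i, \<omega>))) = UNIV" if "\<omega> \<in> space (completed_prob E)" for \<omega>
    using sets_bind[OF sets_kernel[OF \<mu>i'[OF that]] M.not_empty] by simp
  have "AE \<omega> in completed_prob E. measure (Giry_Monad.bind (agents E) (\<lambda>i. \<mu> (i, \<omega>))) {q} =
    signal_frequencies (snd \<omega>) q" for q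
  proof -
    define g where "g = indicat_real (signal_process -` {q} \<inter> space (fubini E))"
    have gi: "(\<lambda>\<omega>. g (i, \<omega>)) = indicat_real {\<omega> \<in> space (completed_prob E). signal_proj i \<omega> \<in> {q}}" for i
      by (auto simp: g_def signal_process_def space_Q agents_space indicator_def)
    have gg: "(\<lambda>\<omega>. g (i, \<omega>) * g (j, \<omega>)) =
        indicat_real {\<omega> \<in> space (completed_prob E). signal_proj i \<omega> \<in> {q} \<and> signal_proj j \<omega> \<in> {q}}" for i j
      by (auto simp: g_def signal_process_def space_Q agents_space indicator_def)
    have "AE \<omega> in completed_prob E. (\<integral>i. g (i, \<omega>) \<partial>agents E) = (\<integral>i. measure (\<mu> (i, \<omega>)) {q} \<partial>agents E)"
    proof (rule exact_law_of_large_numbers[OF subalgebra_state_algebra])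
      have "signal_process -` {q} \<inter> space (fubini E) \<in> sets (fubini E)"
        using signal_process_measurable by (rule measurable_sets) simp
      then show "g \<in> borel_measurable (fubini E)" unfolding g_def by simp
      have "signal_proj i -` {q} \<inter> space (joint E) \<in> sets (joint E)" for i
        using measurable_signal_proj by (rule measurable_sets) simp
      then have "{\<omega> \<in> space (completed_prob E). signal_proj i \<omega> \<in> {q}} \<in> sets (joint E)" for i
        by (simp add: vimage_def Int_def conj_commute completed_prob_def)
      then show "(\<lambda>\<omega>. g (i, \<omega>)) \<in> borel_measurable (completed_prob E)" for i
        unfolding gi by (intro borel_measurable_indicator) (simp add: completed_prob_def)
      show "0 \<le> g p \<and> g p \<le> 1" for p by (simp add: g_def)
      show "(\<lambda>p. measure (\<mu> p) {q}) \<in> borel_measurable (agents E \<Otimes>\<^sub>M state_algebra E)"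
        by (rule measurable_compose[OF \<mu>m measurable_measure_prob_algebra]) simp
      show "0 \<le> measure (\<mu> p) {q} \<and> measure (\<mu> p) {q} \<le> 1" if "p \<in> space (fubini E)" for p
        using \<mu>_prob[of "snd p" "fst p"] that by (auto simp: space_Q intro: prob_space.prob_le_1)
      show "AE p in fubini E. measure (\<mu> p) {q} =
          real_cond_exp (fubini E) (agents E \<Otimes>\<^sub>M state_algebra E) g p"
        unfolding g_def by (rule \<mu>ce)
      have "AE i in agents E. AE j in agents E. \<forall>B1 B2. AE \<omega> in completed_prob E.
          real_cond_exp (completed_prob E) (state_algebra E)
             (indicator {\<omega>\<in>space (completed_prob E). signal_proj i \<omega> \<in> B1 \<and> signal_proj j \<omega> \<in> B2}) \<omega> =
          real_cond_exp (completed_prob E) (state_algebra E)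
             (indicator {\<omega>\<in>space (completed_prob E). signal_proj i \<omega> \<in> B1}) \<omega> *
          real_cond_exp (completed_prob E) (state_algebra E)
             (indicator {\<omega>\<in>space (completed_prob E). signal_proj j \<omega> \<in> B2}) \<omega>"
        using cond_indep by (simp add: ess_pairwise_cond_indep_def Let_def)
      then show "AE i in agents E. AE j in agents E. AE \<omega> in completed_prob E.
         real_cond_exp (completed_prob E) (state_algebra E) (\<lambda>\<omega>. g (i, \<omega>) * g (j, \<omega>)) \<omega> =
         real_cond_exp (completed_prob E) (state_algebra E) (\<lambda>\<omega>. g (i, \<omega>)) \<omega> *
         real_cond_exp (completed_prob E) (state_algebra E) (\<lambda>\<omega>. g (j, \<omega>)) \<omega>"
        unfolding gg gi by (elim eventually_mono allE) 
    qed
    with AE_space show ?thesis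
    proof eventually_elim
      case (elim \<omega>)
      have "(\<integral>i. g (i, \<omega>) \<partial>agents E) = (\<integral>i. indicat_real {i. snd \<omega> i = q} i \<partial>agents E)"
        using elim(1) by (intro Bochner_Integration.integral_cong)
          (auto simp: g_def signal_process_def signal_proj_def space_Q agents_space indicator_def)
      also have "\<dots> = signal_frequencies (snd \<omega>) q"
        by (simp add: signal_frequencies_def agents_space)
      finally show ?case
        using elim by (subst M.measure_bind[OF \<mu>i']) auto
    qed
  qed
  then show "AE \<omega> in completed_prob E. \<forall>q. measure (Giry_Monad.bind (agents E) (\<lambda>i. \<mu> (i, \<omega>))) {q} =
    signal_frequencies (snd \<omega>) q" by (simp add: AE_all_countable)
qed

text \<open>Non-triviality puts the preimages of open sets of states into the sigma-algebra
  generated by the averaged conditional law and the null sets, so the state factors through that law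
  almost surely; the law is then replaced by the frequencies.\<close>

lemma state_determined_by_frequencies:
  obtains \<theta> where "AE \<omega> in completed_prob E. \<theta> (signal_frequencies (snd \<omega>)) = fst \<omega>"
proof -
  obtain \<mu> where \<mu>: "regular_cond_distr (fubini E) (agents E \<Otimes>\<^sub>M state_algebra E) (count_space UNIV) signal_process \<mu>"
    and sets_eq: "sets (gen_sub_algebra (completed_prob E) (prob_algebra (count_space (UNIV :: 'q set)))
        (\<lambda>\<omega>. Giry_Monad.bind (agents E) (\<lambda>i. \<mu> (i, \<omega>)))) = sets (state_algebra E)"
    using nontrivial by (auto simp: nontrivial_signals_def)
  have "fst -` U \<inter> space (completed_prob E) \<in> sets (state_algebra E)" if "open U" for U
    unfolding state_algebra_def state_proj_eq using that by (intro vimage_in_gen_sub_algebra) simp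
  then obtain \<theta> where \<theta>: "AE \<omega> in completed_prob E. \<theta> (Giry_Monad.bind (agents E) (\<lambda>i. \<mu> (i, \<omega>))) = fst \<omega>"
    unfolding sets_eq[symmetric] by (rule gen_sub_algebra_AE_factor)
  show thesis
  proof (rule that)
    show "AE \<omega> in completed_prob E. \<theta> (point_measure UNIV (\<lambda>q. ennreal (signal_frequencies (snd \<omega>) q))) = fst \<omega>"
      using \<theta> average_signal_distr_eq_frequencies(1)[OF \<mu>] AE_space
    proof eventually_elim
      case (elim \<omega>)
      then show ?case
        using measure_on_finite_eq_point_measure[OF average_signal_distr_eq_frequencies(2,3)[OF \<mu>], of \<omega>] by simp
    qed
  qed
qed

end


section \<open>Efficiency\<close>

lemma integral_eq_imp_AE_eq:
  fixes f g :: "'a \<Rightarrow> real"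
  assumes "integrable M f" "integrable M g" and le: "AE x in M. f x \<le> g x"
    and "(\<integral>x. g x \<partial>M) \<le> (\<integral>x. f x \<partial>M)"
  shows "AE x in M. f x = g x"
proof -
  have int: "integrable M (\<lambda>x. g x - f x)" using assms by simp
  have nn: "AE x in M. 0 \<le> g x - f x" using le by eventually_elim simp
  have "(\<integral>x. g x - f x \<partial>M) = 0"
    using assms integral_nonneg_AE[OF nn] by simp
  then have "AE x in M. g x - f x = 0"
    using integral_nonneg_eq_0_iff_AE[OF int nn] by blast
  then show ?thesis by eventually_elim simp
qed

section \<open>Transfer of allocations to the full Fubini space\<close>

context private_information_economy
begin

text \<open>The sets with measurable preimage already form a sigma-algebra, so generating one from
  them adds nothing and \<open>fubini_T\<close> is an image measure; integrals over agents and
  profiles become integrals over \<open>fubini E\<close>.\<close>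

lemma fubini_T_eq_distr:
  defines "\<phi> \<equiv> \<lambda>p. (fst p, snd (snd p)) :: 'i \<times> ('i \<Rightarrow> 'q)"
    and "\<D> \<equiv> {D. D \<subseteq> UNIV \<times> space (profiles E) \<and>
       (\<lambda>p. (fst p, snd (snd p))) -` D \<inter> space (fubini E) \<in> sets (fubini E)}"
  shows "fubini_T E = distr (fubini E) (sigma (UNIV \<times> space (profiles E)) \<D>) \<phi>"
    and "space (sigma (UNIV \<times> space (profiles E)) \<D>) = UNIV \<times> space (profiles E)"
    and "sets (sigma (UNIV \<times> space (profiles E)) \<D>) = \<D>"
    and "\<phi> \<in> measurable (fubini E) (sigma (UNIV \<times> space (profiles E)) \<D>)"
proof -
  let ?S = "UNIV \<times> space (profiles E)"
  have pow: "\<D> \<subseteq> Pow ?S" by (auto simp: \<D>_def)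
  have "sigma_algebra ?S \<D>"
    unfolding sigma_algebra_iff2
  proof (intro conjI ballI allI impI)
    fix D assume D: "D \<in> \<D>"
    have "\<phi> -` (?S - D) \<inter> space (fubini E) = space (fubini E) - (\<phi> -` D \<inter> space (fubini E))"
      by (auto simp: \<phi>_def space_fubini)
    with D show "?S - D \<in> \<D>" by (auto simp: \<D>_def \<phi>_def)
  next
    fix A :: "nat \<Rightarrow> _" assume A: "range A \<subseteq> \<D>"
    have "\<phi> -` (\<Union>i. A i) \<inter> space (fubini E) = (\<Union>i. \<phi> -` A i \<inter> space (fubini E))" by auto
    moreover have "(\<Union>i. \<phi> -` A i \<inter> space (fubini E)) \<in> sets (fubini E)"
      by (rule sets.countable_UN) (use A in \<open>auto simp: \<D>_def \<phi>_def\<close>)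
    moreover have "(\<Union>i. A i) \<subseteq> ?S" using A by (auto simp: \<D>_def)
    ultimately show "(\<Union>i. A i) \<in> \<D>"
      unfolding \<D>_def \<phi>_def[symmetric] by simp
  qed (auto simp: \<D>_def)
  then show sets: "sets (sigma ?S \<D>) = \<D>" by (rule sigma_algebra.sets_measure_of_eq)
  show sp: "space (sigma ?S \<D>) = ?S" using pow by (rule space_measure_of)
  show "\<phi> \<in> measurable (fubini E) (sigma ?S \<D>)"
    by (rule measurableI) (auto simp: sp sets, auto simp: \<phi>_def \<D>_def space_fubini)
  have pre: "{(i, s, t). (i, s, t) \<in> space (fubini E) \<and> (i, t) \<in> D} = \<phi> -` D \<inter> space (fubini E)" for D
    by (auto simp: \<phi>_def)
  show "fubini_T E = distr (fubini E) (sigma ?S \<D>) \<phi>"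
    unfolding distr_def sets sp unfolding fubini_T_def Let_def pre by (simp add: \<D>_def \<phi>_def)
qed

text \<open>The sigma-algebra on agents and profiles is the largest one that makes the projection
  measurable. Hence measurability of the composition descends to \<open>x\<close>, which would fail
  for a general image measure.\<close>

lemma integrable_fubini_T_iff:
  fixes x :: "'i \<Rightarrow> ('i \<Rightarrow> 'q) \<Rightarrow> 'c::{banach, second_countable_topology}"
  shows "integrable (fubini_T E) (\<lambda>(i, t). x i t) \<longleftrightarrow> integrable (fubini E) (\<lambda>p. x (fst p) (snd (snd p)))"
proof
  assume "integrable (fubini_T E) (\<lambda>(i, t). x i t)"
  from integrable_distr[OF fubini_T_eq_distr(4) this[unfolded fubini_T_eq_distr(1)]]
  show "integrable (fubini E) (\<lambda>p. x (fst p) (snd (snd p)))" by simp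
next
  let ?x = "\<lambda>(i, t). x i t"
  assume int: "integrable (fubini E) (\<lambda>p. x (fst p) (snd (snd p)))"
  have "?x \<in> borel_measurable (fubini_T E)"
  proof (rule measurableI)
    fix A :: "'c set" assume "A \<in> sets borel"
    then have A: "(\<lambda>p. x (fst p) (snd (snd p))) -` A \<inter> space (fubini E) \<in> sets (fubini E)"
      by (rule measurable_sets[OF borel_measurable_integrable[OF int]])
    have "(\<lambda>p. (fst p, snd (snd p))) -` (?x -` A \<inter> UNIV \<times> space (profiles E)) \<inter> space (fubini E)
        = (\<lambda>p. x (fst p) (snd (snd p))) -` A \<inter> space (fubini E)"
      by (auto simp: space_fubini)
    with A show "?x -` A \<inter> space (fubini_T E) \<in> sets (fubini_T E)"
      unfolding fubini_T_eq_distr(1) sets_distr space_distr fubini_T_eq_distr(2,3) by auto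
  qed simp
  then show "integrable (fubini_T E) ?x"
    using int unfolding fubini_T_eq_distr(1)
    by (subst integrable_distr_eq[OF fubini_T_eq_distr(4)]) simp_all
qed

lemma allocation_iff:
  "allocation E x \<longleftrightarrow> (\<forall>i. \<forall>t\<in>space (profiles E). 0 \<le> x i t) \<and>
     integrable (fubini E) (\<lambda>p. x (fst p) (snd (snd p)))"
  by (simp add: allocation_def integrable_fubini_T_iff)

lemma feasible_iff:
  "feasible E x \<longleftrightarrow> allocation E x \<and>
     (AE \<omega> in completed_prob E. (\<integral>i. x i (snd \<omega>) \<partial>agents E) = (\<integral>i. endowment E i \<partial>agents E))"
  by (simp add: feasible_def AE_prob_T_iff)

end

section \<open>Ex ante utilities and weak improvements\<close>

locale regular_economy = private_information_economy E
  for E :: "('i, 's::polish_space, 'q::finite, 'm::finite) economy" +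
  assumes A1: "assumption_A1 E"
begin

lemma utility_measurable: "0 \<le> x \<Longrightarrow> (\<lambda>(i, s). utility E i x s) \<in> borel_measurable (agents E \<Otimes>\<^sub>M borel)"
  using A1 by (simp add: assumption_A1_def)

lemma utility_continuous: "continuous_on {x. 0 \<le> x} (\<lambda>x. utility E i x s)"
  using A1 by (auto simp: assumption_A1_def)

lemma utility_strict_mono:
  assumes "0 \<le> x" "x \<le> y" "x \<noteq> y"
  shows "utility E i x s < utility E i y s"
  using A1 assms order_trans[OF assms(1,2)] unfolding assumption_A1_def by metis

lemma utility_mono: "0 \<le> x \<Longrightarrow> x \<le> y \<Longrightarrow> utility E i x s \<le> utility E i y s"
  using utility_strict_mono[of x y i s] by (cases "x = y") auto

definition state_util :: "'i \<times> 's \<times> ('i \<Rightarrow> 'q) \<Rightarrow> real ^ 'm \<Rightarrow> real" where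
  "state_util p x = utility E (fst p) x (fst (snd p))"

lemma ex_ante_utility_eq:
  "ex_ante_utility E i z = (\<integral>\<omega>. state_util (i, \<omega>) (z (snd \<omega>)) \<partial>completed_prob E)"
  by (simp add: ex_ante_utility_def state_util_def split_beta')

lemma measurable_agent_state:
  "(\<lambda>p. (fst p, fst (snd p))) \<in> measurable (fubini E) (agents E \<Otimes>\<^sub>M borel)"
  by (intro measurable_Pair measurable_fst_Q
      measurable_compose[OF measurable_snd_Q measurable_joint_completed[OF measurable_fst_joint]])

text \<open>Continuity in the bundle gives measurability along \<open>z\<close>, and the linear
  growth bound of A1 dominates the utility by an integrable function.\<close>

lemma integrable_state_util:
  assumes z: "integrable (fubini E) z" and nonneg: "\<And>p. p \<in> space (fubini E) \<Longrightarrow> 0 \<le> z p"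
  shows "integrable (fubini E) (\<lambda>p. state_util p (z p))"
proof -
  obtain c d where cd: "\<And>i x s. 0 \<le> x \<Longrightarrow> utility E i x s \<le> c * norm x + d"
    using A1 unfolding assumption_A1_def by blast
  have meas: "(\<lambda>p. state_util p (z p)) \<in> borel_measurable (fubini E)"
  proof (rule caratheodory_measurable[OF _ _ borel_measurable_integrable[OF z] nonneg])
    show "(\<lambda>p. state_util p x) \<in> borel_measurable (fubini E)" if "0 \<le> x" for x
      using measurable_compose[OF measurable_agent_state utility_measurable[OF that]]
      by (simp add: state_util_def)
    show "continuous_on {x. 0 \<le> x} (state_util p)" for p
      using utility_continuous by (simp add: state_util_def[abs_def])
  qed
  have bound: "AE p in fubini E. norm (state_util p (z p)) \<le> norm (c * norm (z p) + d)"
  proof (rule AE_I2)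
    fix p assume "p \<in> space (fubini E)"
    then have "0 \<le> state_util p (z p)" "state_util p (z p) \<le> c * norm (z p) + d"
      using nonneg utility_nonneg cd by (auto simp: state_util_def)
    then show "norm (state_util p (z p)) \<le> norm (c * norm (z p) + d)" by simp
  qed
  show ?thesis
    by (rule Bochner_Integration.integrable_bound[OF _ meas bound]) (use z in auto)
qed

lemma
  assumes x: "allocation E x"
  shows integrable_alloc_util: "integrable (fubini E) (\<lambda>p. state_util p (x (fst p) (snd (snd p))))"
    and AE_integrable_alloc_util:
      "AE i in agents E. integrable (completed_prob E) (\<lambda>\<omega>. state_util (i, \<omega>) (x i (snd \<omega>)))"
    and integrable_ex_ante_utility: "integrable (agents E) (\<lambda>i. ex_ante_utility E i (x i))"
proof -
  show *: "integrable (fubini E) (\<lambda>p. state_util p (x (fst p) (snd (snd p))))"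
    using x by (intro integrable_state_util) (auto simp: allocation_iff space_fubini)
  show "AE i in agents E. integrable (completed_prob E) (\<lambda>\<omega>. state_util (i, \<omega>) (x i (snd \<omega>)))"
    using AE_integrable_fst[OF *] by simp
  show "integrable (agents E) (\<lambda>i. ex_ante_utility E i (x i))"
    using integrable_fst[OF *] by (simp add: ex_ante_utility_eq)
qed

text \<open>Where the expected utilities coincide, the ordered integrands coincide almost surely,
  and strict monotonicity leaves no room for different bundles.\<close>

lemma AE_ex_ante_utility_mono:
  assumes x: "allocation E x" and y: "allocation E y"
    and le: "\<And>i t. t \<in> space (profiles E) \<Longrightarrow> x i t \<le> y i t"
  shows "AE i in agents E. ex_ante_utility E i (x i) \<le> ex_ante_utility E i (y i) \<and>
    (ex_ante_utility E i (y i) \<le> ex_ante_utility E i (x i) \<longrightarrow>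
      (AE \<omega> in completed_prob E. x i (snd \<omega>) = y i (snd \<omega>)))"
  using AE_integrable_alloc_util[OF x] AE_integrable_alloc_util[OF y]
proof eventually_elim
  case (elim i)
  have nn: "0 \<le> x i t" if "t \<in> space (profiles E)" for t
    using x that by (simp add: allocation_iff)
  have mono: "AE \<omega> in completed_prob E. state_util (i, \<omega>) (x i (snd \<omega>)) \<le> state_util (i, \<omega>) (y i (snd \<omega>))"
    unfolding state_util_def by (intro AE_I2 utility_mono nn le) (auto simp: space_P)
  show ?case
  proof (intro conjI impI)
    show "ex_ante_utility E i (x i) \<le> ex_ante_utility E i (y i)"
      unfolding ex_ante_utility_eq using elim mono by (rule integral_mono_AE)
    assume "ex_ante_utility E i (y i) \<le> ex_ante_utility E i (x i)"
    from integral_eq_imp_AE_eq[OF elim mono this[unfolded ex_ante_utility_eq]] AE_space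
    show "AE \<omega> in completed_prob E. x i (snd \<omega>) = y i (snd \<omega>)"
    proof eventually_elim
      case (elim \<omega>)
      then have "snd \<omega> \<in> space (profiles E)" by (auto simp: space_P)
      then have "0 \<le> x i (snd \<omega>)" "x i (snd \<omega>) \<le> y i (snd \<omega>)" using nn le by auto
      from utility_strict_mono[OF this, of i "fst \<omega>"] elim(1) show ?case
        by (cases "x i (snd \<omega>) = y i (snd \<omega>)") (auto simp: state_util_def)
    qed
  qed
qed

text \<open>Otherwise a positive mass of agents could be charged a fraction of their bundles, to be
  distributed equally among all agents, so that everybody gains.\<close>

lemma weak_pareto:
  assumes eff: "ex_ante_efficient E x" and y: "feasible E y"
    and le: "AE i in agents E. ex_ante_utility E i (x i) \<le> ex_ante_utility E i (y i)"
  shows "AE i in agents E. ex_ante_utility E i (x i) = ex_ante_utility E i (y i)"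
proof (rule ccontr)
  assume neq: "\<not> ?thesis"
  have x_alloc: "allocation E x" and y_alloc: "allocation E y"
    using eff y by (simp_all add: ex_ante_efficient_def feasible_def)
  have y_int: "integrable (fubini E) (\<lambda>p. y (fst p) (snd (snd p)))"
    and y_nn: "\<And>i t. t \<in> space (profiles E) \<Longrightarrow> 0 \<le> y i t"
    and x_nn: "\<And>i t. t \<in> space (profiles E) \<Longrightarrow> 0 \<le> x i t"
    using x_alloc y_alloc by (auto simp: allocation_iff)
  \<comment> \<open>The shift by two gives fractions strictly between 0 and 1, also at
    \<open>n = 0\<close>.\<close>
  define \<epsilon> where "\<epsilon> n = 1 / real (Suc (Suc n))" for n
  have \<epsilon>: "0 < \<epsilon> n" "\<epsilon> n < 1" for n by (auto simp: \<epsilon>_def)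
  have \<epsilon>_lim: "\<epsilon> \<longlonglongrightarrow> 0"
    unfolding \<epsilon>_def by (intro LIMSEQ_Suc lim_1_over_n)
  have scaled: "allocation E (\<lambda>i t. (1 - \<epsilon> n) *\<^sub>R y i t)" for n
    unfolding allocation_iff using y_int y_nn \<epsilon>[of n] by (auto intro!: scaleR_nonneg_nonneg)
  define U where "U n i = ex_ante_utility E i (\<lambda>t. (1 - \<epsilon> n) *\<^sub>R y i t)" for n i
  define A where "A n = {i. ex_ante_utility E i (x i) < U n i}" for n
  have A_sets: "A n \<in> sets (agents E)" for n
  proof -
    note [measurable] = borel_measurable_integrable[OF integrable_ex_ante_utility[OF scaled, of n]]
      borel_measurable_integrable[OF integrable_ex_ante_utility[OF x_alloc]]
    have "{i \<in> space (agents E). ex_ante_utility E i (x i) < U n i} \<in> sets (agents E)"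
      unfolding U_def by measurable
    then show ?thesis by (simp add: A_def agents_space)
  qed
  have U_lim: "AE i in agents E. (\<lambda>n. U n i) \<longlonglongrightarrow> ex_ante_utility E i (y i)"
  proof -
    have "AE i in agents E. \<forall>n. integrable (completed_prob E) (\<lambda>\<omega>. state_util (i, \<omega>) ((1 - \<epsilon> n) *\<^sub>R y i (snd \<omega>)))"
      unfolding AE_all_countable by (intro allI AE_integrable_alloc_util[OF scaled])
    with AE_integrable_alloc_util[OF y_alloc] show ?thesis
    proof eventually_elim
      case (elim i)
      show ?case
        unfolding U_def ex_ante_utility_eq
      \<comment> \<open>Monotonicity and nonnegativity let the utility of the full bundle dominate
        the utilities of the reduced ones.\<close>
      proof (rule integral_dominated_convergence[where w="\<lambda>\<omega>. state_util (i, \<omega>) (y i (snd \<omega>))"])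
        show "AE \<omega> in completed_prob E. (\<lambda>n. state_util (i, \<omega>) ((1 - \<epsilon> n) *\<^sub>R y i (snd \<omega>)))
            \<longlonglongrightarrow> state_util (i, \<omega>) (y i (snd \<omega>))"
        proof (rule AE_I2)
          fix \<omega> assume "\<omega> \<in> space (completed_prob E)"
          then have t: "snd \<omega> \<in> space (profiles E)" by (auto simp: space_P)
          have "(\<lambda>n. (1 - \<epsilon> n) *\<^sub>R y i (snd \<omega>)) \<longlonglongrightarrow> (1 - 0) *\<^sub>R y i (snd \<omega>)"
            by (intro tendsto_intros \<epsilon>_lim)
          then show "(\<lambda>n. state_util (i, \<omega>) ((1 - \<epsilon> n) *\<^sub>R y i (snd \<omega>))) \<longlonglongrightarrow> state_util (i, \<omega>) (y i (snd \<omega>))"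
            unfolding state_util_def
            by (intro continuous_on_tendsto_compose[OF utility_continuous])
               (use y_nn[OF t] \<epsilon> in \<open>auto intro!: always_eventually scaleR_nonneg_nonneg simp: less_imp_le\<close>)
        qed
        show "AE \<omega> in completed_prob E. norm (state_util (i, \<omega>) ((1 - \<epsilon> n) *\<^sub>R y i (snd \<omega>)))
            \<le> state_util (i, \<omega>) (y i (snd \<omega>))" for n
        proof (rule AE_I2)
          fix \<omega> assume "\<omega> \<in> space (completed_prob E)"
          then have t: "snd \<omega> \<in> space (profiles E)" by (auto simp: space_P)
          have 0: "0 \<le> (1 - \<epsilon> n) *\<^sub>R y i (snd \<omega>)"
            using y_nn[OF t] \<epsilon>[of n] by (intro scaleR_nonneg_nonneg) auto
          have "(1 - \<epsilon> n) *\<^sub>R y i (snd \<omega>) \<le> 1 *\<^sub>R y i (snd \<omega>)"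
            using y_nn[OF t] \<epsilon>[of n] by (intro scaleR_right_mono) auto
          then show "norm (state_util (i, \<omega>) ((1 - \<epsilon> n) *\<^sub>R y i (snd \<omega>))) \<le> state_util (i, \<omega>) (y i (snd \<omega>))"
            unfolding state_util_def using utility_mono[OF 0] utility_nonneg[OF 0] by simp
        qed
      qed (use elim in auto)
    qed
  qed
  \<comment> \<open>Some fraction is small enough to leave a positive mass of strict gainers: if all
    \<open>A n\<close> were null, the limit of \<open>U n i\<close> would bound the utility of
    \<open>y\<close> by that of \<open>x\<close> for almost all agents.\<close>
  obtain n where n: "\<not> (AE i in agents E. i \<notin> A n)"
  proof (rule ccontr)
    assume "\<not> thesis"
    then have "\<And>n. AE i in agents E. i \<notin> A n" using that by blast
    then have "AE i in agents E. \<forall>n. i \<notin> A n" by (simp add: AE_all_countable)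
    with U_lim le have "AE i in agents E. ex_ante_utility E i (x i) = ex_ante_utility E i (y i)"
    proof eventually_elim
      case (elim i)
      then have "ex_ante_utility E i (y i) \<le> ex_ante_utility E i (x i)"
        by (intro LIMSEQ_le_const2[OF elim(1)]) (auto simp: A_def not_less)
      with elim show ?case by simp
    qed
    with neq show False by simp
  qed
  define B where "B = A n"
  have B[measurable]: "B \<in> sets (agents E)" by (simp add: B_def A_sets)
  define yB where "yB p = indicat_real B (fst p) *\<^sub>R y (fst p) (snd (snd p))"
    for p :: "'i \<times> 's \<times> ('i \<Rightarrow> 'q)"
  \<comment> \<open>The charge collected from the agents in \<open>B\<close>; as the agents have
    total mass 1, giving \<open>W t\<close> to everyone returns exactly what was collected.\<close>
  define W where "W t = \<epsilon> n *\<^sub>R (\<integral>i. indicat_real B i *\<^sub>R y i t \<partial>agents E)" for t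
  define z where "z i t = (1 - \<epsilon> n * indicat_real B i) *\<^sub>R y i t + W t" for i t
  have yB: "integrable (fubini E) yB"
  proof (rule Bochner_Integration.integrable_bound[OF y_int])
    show "yB \<in> borel_measurable (fubini E)"
      unfolding yB_def using borel_measurable_integrable[OF y_int] by measurable
  qed (auto simp: yB_def indicator_def)
  have yB_nn: "0 \<le> yB p" if "p \<in> space (fubini E)" for p
    using that y_nn unfolding yB_def by (intro scaleR_nonneg_nonneg) (auto simp: space_fubini)
  have W_nn: "0 \<le> W t" if "t \<in> space (profiles E)" for t
    unfolding W_def using \<epsilon>[of n] y_nn[OF that]
    by (intro scaleR_nonneg_nonneg integral_vec_nonneg AE_I2) (auto intro!: scaleR_nonneg_nonneg)
  have W_int: "integrable (completed_prob E) (\<lambda>\<omega>. W (snd \<omega>))"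
    using integrable_snd_vec[OF yB] by (simp add: W_def yB_def)
  have z_ge1: "(1 - \<epsilon> n) *\<^sub>R y i t \<le> z i t" if "t \<in> space (profiles E)" for i t
  proof -
    have "(1 - \<epsilon> n) *\<^sub>R y i t \<le> (1 - \<epsilon> n * indicat_real B i) *\<^sub>R y i t"
      using y_nn[OF that] \<epsilon>[of n] by (intro scaleR_right_mono) (auto simp: indicator_def)
    with W_nn[OF that] show ?thesis unfolding z_def by (rule add_increasing2)
  qed
  have z_nn: "0 \<le> z i t" if "t \<in> space (profiles E)" for i t
    by (rule order_trans[OF scaleR_nonneg_nonneg z_ge1]) (use \<epsilon>[of n] y_nn that in auto)
  have z_alloc: "allocation E z"
    unfolding allocation_iff
  proof (intro conjI allI ballI z_nn)
    have "integrable (fubini E) (\<lambda>p. y (fst p) (snd (snd p)) - \<epsilon> n *\<^sub>R yB p + W (snd (snd p)))"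
      using y_int yB integrable_Q_snd[OF W_int] by simp
    then show "integrable (fubini E) (\<lambda>p. z (fst p) (snd (snd p)))"
      by (simp add: z_def yB_def algebra_simps)
  qed
  have "AE \<omega> in completed_prob E. (\<integral>i. z i (snd \<omega>) \<partial>agents E) = (\<integral>i. y i (snd \<omega>) \<partial>agents E)"
    using AE_integrable_snd_vec[OF y_int] AE_integrable_snd_vec[OF yB]
  proof eventually_elim
    case (elim \<omega>)
    then have int: "integrable (agents E) (\<lambda>i. y i (snd \<omega>))" "integrable (agents E) (\<lambda>i. indicat_real B i *\<^sub>R y i (snd \<omega>))"
      by (simp_all add: yB_def)
    have "(\<integral>i. z i (snd \<omega>) \<partial>agents E) =
        (\<integral>i. y i (snd \<omega>) - \<epsilon> n *\<^sub>R (indicat_real B i *\<^sub>R y i (snd \<omega>)) + W (snd \<omega>) \<partial>agents E)"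
      by (simp add: z_def algebra_simps)
    also have "\<dots> = (\<integral>i. y i (snd \<omega>) \<partial>agents E) - W (snd \<omega>) + W (snd \<omega>)"
      using int W_def[of "snd \<omega>"] by (simp add: M.prob_space del: scaleR_scaleR)
    finally show ?case by simp
  qed
  moreover have "AE \<omega> in completed_prob E. (\<integral>i. y i (snd \<omega>) \<partial>agents E) = (\<integral>i. endowment E i \<partial>agents E)"
    using y by (simp add: feasible_iff)
  ultimately have "AE \<omega> in completed_prob E. (\<integral>i. z i (snd \<omega>) \<partial>agents E) = (\<integral>i. endowment E i \<partial>agents E)"
    by eventually_elim simp
  with z_alloc have z_feas: "feasible E z" by (simp add: feasible_iff)
  \<comment> \<open>If nothing were collected, almost all agents in \<open>B\<close> would hold the
    zero bundle under \<open>y\<close> almost surely. Their reduced utility would be that of the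
    zero bundle, which cannot exceed the utility of \<open>x\<close>, against the choice of
    \<open>B\<close>.\<close>
  have W_pos: "\<not> (AE \<omega> in completed_prob E. W (snd \<omega>) = 0)"
  proof
    assume W0: "AE \<omega> in completed_prob E. W (snd \<omega>) = 0"
    have "AE p in fubini E. yB p $ k = 0" for k
    proof -
      have yBk: "integrable (fubini E) (\<lambda>p. yB p $ k)" using yB integrable_vec_iff by blast
      have "(\<integral>p. yB p $ k \<partial>fubini E) = (\<integral>\<omega>. (\<integral>i. yB (i, \<omega>) $ k \<partial>agents E) \<partial>completed_prob E)"
        by (rule integral_snd[OF yBk])
      also have "\<dots> = (\<integral>\<omega>. 0 \<partial>completed_prob E)"
      proof (rule integral_cong_AE)
        show "AE \<omega> in completed_prob E. (\<integral>i. yB (i, \<omega>) $ k \<partial>agents E) = 0"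
          using W0 AE_integrable_snd_vec[OF yB]
        proof eventually_elim
          case (elim \<omega>)
          then have "(\<integral>i. yB (i, \<omega>) \<partial>agents E) = 0"
            using \<epsilon>(1)[of n] by (simp add: W_def yB_def)
          with integral_vec_nth[OF elim(2), of k] show ?case by simp
        qed
      qed (use integrable_snd[OF yBk] in auto)
      finally have "(\<integral>p. yB p $ k \<partial>fubini E) = 0" by simp
      moreover have "AE p in fubini E. 0 \<le> yB p $ k"
        using yB_nn by (intro AE_I2) (simp add: less_eq_vec_def)
      ultimately show ?thesis
        using integral_nonneg_eq_0_iff_AE[OF yBk] by blast
    qed
    then have "AE p in fubini E. \<forall>k. yB p $ k = 0" by (simp add: AE_all_countable)
    then have "AE p in fubini E. yB p = 0" by eventually_elim (simp add: vec_eq_iff)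
    then have *: "AE i in agents E. AE \<omega> in completed_prob E. yB (i, \<omega>) = 0" by (rule AE_AE_fst)
    have zero: "allocation E (\<lambda>i t. 0)" by (simp add: allocation_iff)
    have "AE i in agents E. ex_ante_utility E i (\<lambda>t. 0) \<le> ex_ante_utility E i (x i) \<and>
        (ex_ante_utility E i (x i) \<le> ex_ante_utility E i (\<lambda>t. 0) \<longrightarrow> (AE \<omega> in completed_prob E. 0 = x i (snd \<omega>)))"
      by (rule AE_ex_ante_utility_mono[OF zero x_alloc]) (rule x_nn)
    with * have "AE i in agents E. i \<notin> B"
      using
        AE_integrable_alloc_util[OF zero] AE_integrable_alloc_util[OF scaled, of n]
    proof eventually_elim
      case (elim i)
      show ?case
      proof
        assume i: "i \<in> B"
        have "U n i = ex_ante_utility E i (\<lambda>t. 0)"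
          unfolding U_def ex_ante_utility_eq
        proof (rule integral_cong_AE)
          show "AE \<omega> in completed_prob E. state_util (i, \<omega>) ((1 - \<epsilon> n) *\<^sub>R y i (snd \<omega>)) = state_util (i, \<omega>) 0"
            using elim(1) by eventually_elim (use i in \<open>simp add: yB_def\<close>)
        qed (use elim(3,4) in auto)
        with elim(2) i show False by (simp add: B_def A_def)
      qed
    qed
    with n show False by (simp add: B_def)
  qed
  have "AE i in agents E. U n i \<le> ex_ante_utility E i (z i)"
    using AE_ex_ante_utility_mono[OF scaled z_alloc, of n] z_ge1 unfolding U_def
    by (auto elim: eventually_mono)
  with le have "AE i in agents E. ex_ante_utility E i (x i) < ex_ante_utility E i (z i)"
    using AE_integrable_alloc_util[OF y_alloc]
      AE_integrable_alloc_util[OF z_alloc]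
  proof eventually_elim
    case (elim i)
    show ?case
    \<comment> \<open>Agents in \<open>B\<close> gain even after the charge, and the refund only
      adds to it. The others keep \<open>y\<close> and receive \<open>W\<close>, which is
      nonnegative and not almost surely 0, so strict monotonicity makes them gain.\<close>
    proof (cases "i \<in> B")
      case True
      with elim(2) show ?thesis by (simp add: B_def A_def)
    next
      case False
      then have zi: "z i t = y i t + W t" for t by (simp add: z_def)
      have "ex_ante_utility E i (y i) < ex_ante_utility E i (z i)"
      proof (rule ccontr)
        assume "\<not> ?thesis"
        then have "ex_ante_utility E i (z i) \<le> ex_ante_utility E i (y i)" by simp
        moreover have "AE \<omega> in completed_prob E. state_util (i, \<omega>) (y i (snd \<omega>)) \<le> state_util (i, \<omega>) (z i (snd \<omega>))"
          unfolding state_util_def zi using y_nn W_nn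
          by (intro AE_I2 utility_mono) (auto simp: space_P)
        ultimately have "AE \<omega> in completed_prob E. state_util (i, \<omega>) (y i (snd \<omega>)) = state_util (i, \<omega>) (z i (snd \<omega>))"
          unfolding ex_ante_utility_eq using elim(3,4) by (intro integral_eq_imp_AE_eq)
        with AE_space have "AE \<omega> in completed_prob E. W (snd \<omega>) = 0"
        proof eventually_elim
          case (elim \<omega>)
          then have "snd \<omega> \<in> space (profiles E)" by (auto simp: space_P)
          then have "0 \<le> y i (snd \<omega>)" "0 \<le> W (snd \<omega>)" using y_nn W_nn by auto
          with utility_strict_mono[of "y i (snd \<omega>)" "y i (snd \<omega>) + W (snd \<omega>)" i "fst \<omega>"] elim(2)
          show ?case by (auto simp: state_util_def zi)
        qed
        with W_pos show False by contradiction
      qed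
      with elim(1) show ?thesis by simp
    qed
  qed
  with eff z_feas show False by (auto simp: ex_ante_efficient_def)
qed

end


section \<open>Averaging over signals\<close>

text \<open>Preimages of single points, closed in a T1 space, are unions of fibres of
  \<open>\<pi>\<close>. This lets a conditional expectation given agent and state be evaluated at
  any reference profile.\<close>

lemma vimage_algebra_measurable_cong:
  fixes f :: "'a \<Rightarrow> 'c::t1_space"
  assumes f: "f \<in> borel_measurable (vimage_algebra X \<pi> L)" and \<pi>: "\<pi> \<in> X \<rightarrow> space L"
    and x: "x \<in> X" "x' \<in> X" "\<pi> x = \<pi> x'"
  shows "f x = f x'"
proof -
  have "f -` {f x} \<inter> space (vimage_algebra X \<pi> L) \<in> sets (vimage_algebra X \<pi> L)"
    by (rule measurable_sets[OF f]) simp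
  then obtain A where A: "f -` {f x} \<inter> X = \<pi> -` A \<inter> X"
    unfolding sets_vimage_algebra2[OF \<pi>] by auto
  have "x \<in> f -` {f x} \<inter> X" using x by simp
  then have "x' \<in> f -` {f x} \<inter> X" unfolding A using x by simp
  then show ?thesis by simp
qed

lemma subalgebra_vimage_algebra:
  assumes "\<pi> \<in> measurable M L"
  shows "subalgebra M (vimage_algebra (space M) \<pi> L)"
  using sets_image_in_sets[OF refl assms] by (simp add: subalgebra_def)

context regular_economy
begin

text \<open>The new allocation is the conditional expectation of the given one with respect to agent
  and state, where the state is read off the frequencies of the reported signals.\<close>

lemma frequency_based_improvement:
  assumes x: "feasible E x" and conc: "\<And>i s. concave_on {x. 0 \<le> x} (\<lambda>x. utility E i x s)"
  obtains y where "feasible E y"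
    "AE i in agents E. ex_ante_utility E i (x i) \<le> ex_ante_utility E i (y i)"
    "\<And>i t q. t \<in> space (profiles E) \<Longrightarrow> y i (t(i := q)) = y i t"
proof -
  have x_alloc: "allocation E x" using x by (simp add: feasible_def)
  have x_int: "integrable (fubini E) (\<lambda>p. x (fst p) (snd (snd p)))"
    and x_nn: "\<And>i t. t \<in> space (profiles E) \<Longrightarrow> 0 \<le> x i t"
    using x_alloc by (auto simp: allocation_iff)
  have xk_int: "integrable (fubini E) (\<lambda>p. x (fst p) (snd (snd p)) $ k)" for k
    using x_int unfolding integrable_vec_iff by blast
  obtain \<theta> where \<theta>: "AE \<omega> in completed_prob E. \<theta> (signal_frequencies (snd \<omega>)) = fst \<omega>"
    by (rule state_determined_by_frequencies)
  obtain t0 where t0: "t0 \<in> space (profiles E)" using profiles_nonempty by blast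
  define \<pi> where "\<pi> p = (fst p, fst (snd p))" for p :: "'i \<times> 's \<times> ('i \<Rightarrow> 'q)"
  define G where "G = vimage_algebra (space (fubini E)) \<pi> (agents E \<Otimes>\<^sub>M borel)"
  have \<pi>m: "\<pi> \<in> measurable (fubini E) (agents E \<Otimes>\<^sub>M borel)"
    unfolding \<pi>_def by (rule measurable_agent_state)
  have \<pi>_fun: "\<pi> \<in> space (fubini E) \<rightarrow> space (agents E \<Otimes>\<^sub>M borel)"
    using measurable_space[OF \<pi>m] by blast
  have \<pi>G: "\<pi> \<in> measurable G (agents E \<Otimes>\<^sub>M borel)"
    unfolding G_def by (rule measurable_vimage_algebra1[OF \<pi>_fun])
  interpret G: finite_measure_subalgebra "fubini E" G
    by standard (simp add: G_def subalgebra_vimage_algebra[OF \<pi>m])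
  define c where "c k = real_cond_exp (fubini E) G (\<lambda>p. x (fst p) (snd (snd p)) $ k)" for k
  \<comment> \<open>\<open>c k\<close> does not vary with the signals, so the fixed profile
    \<open>t0\<close> may stand in for the actual one and \<open>\<xi>\<close> depends on agent and
    state only. The maximum with 0 enforces nonnegativity at every point, as an allocation requires;
    the conditional expectation has it only almost surely.\<close>
  define \<xi> where "\<xi> i s = (\<chi> k. max 0 (c k (i, s, t0)))" for i s
  define y where "y i t = \<xi> i (\<theta> (signal_frequencies t))" for i t
  have cG: "c k \<in> borel_measurable G" for k by (simp add: c_def)
  have c_int: "integrable (fubini E) (c k)" for k unfolding c_def by (rule G.real_cond_exp_int(1)[OF xk_int])
  have c_eq: "c k p = c k (fst p, fst (snd p), t0)" if "p \<in> space (fubini E)" for k p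
    by (rule vimage_algebra_measurable_cong[OF cG[unfolded G_def] \<pi>_fun])
       (use that t0 in \<open>auto simp: \<pi>_def space_fubini\<close>)
  have "AE p in fubini E. 0 \<le> c k p" for k
    unfolding c_def using x_nn borel_measurable_integrable[OF xk_int]
    by (intro G.real_cond_exp_pos AE_I2) (auto simp: less_eq_vec_def space_fubini)
  then have "AE p in fubini E. \<forall>k. 0 \<le> c k p" by (simp add: AE_all_countable)
  with AE_space have \<xi>_c: "AE p in fubini E. \<xi> (fst p) (fst (snd p)) = (\<chi> k. c k p)"
    by eventually_elim (simp add: \<xi>_def vec_eq_iff c_eq[symmetric])
  have y_\<xi>_fst: "AE \<omega> in completed_prob E. \<forall>i. y i (snd \<omega>) = \<xi> i (fst \<omega>)"
    using \<theta> by eventually_elim (simp add: y_def)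
  have y_\<xi>: "AE p in fubini E. y (fst p) (snd (snd p)) = \<xi> (fst p) (fst (snd p))"
    using AE_Q_snd[OF y_\<xi>_fst] by eventually_elim simp
  have y_c: "AE p in fubini E. (\<chi> k. c k p) = y (fst p) (snd (snd p))"
    using y_\<xi> \<xi>_c by eventually_elim simp
  have c_vec: "integrable (fubini E) (\<lambda>p. \<chi> k. c k p)"
    using c_int by (simp add: integrable_vec_iff)
  have y_nn: "0 \<le> y i t" for i t by (simp add: y_def \<xi>_def less_eq_vec_def)
  \<comment> \<open>\<open>\<theta>\<close> need not be measurable; \<open>y\<close> inherits
    measurability from \<open>c\<close>, with which it agrees almost everywhere, by completeness of
    the extension.\<close>
  have "integrable (fubini E) (\<lambda>p. y (fst p) (snd (snd p)))"
    by (rule integrable_cong_AE_imp[OF c_vec Q.measurable_AE_cong[OF borel_measurable_integrable[OF c_vec] y_c] y_c]) simp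
  with y_nn have y_alloc: "allocation E y" by (simp add: allocation_iff)
  have y_int: "integrable (fubini E) (\<lambda>p. y (fst p) (snd (snd p)))"
    using y_alloc by (simp add: allocation_iff)
  \<comment> \<open>Aggregation commutes with conditioning on the state: the aggregate of
    \<open>x\<close> is almost surely the constant \<open>e\<close>, so the aggregate
    \<open>K\<close> of \<open>\<xi>\<close> is the conditional expectation of a constant.\<close>
  have "AE \<omega> in completed_prob E. (\<integral>i. y i (snd \<omega>) $ k \<partial>agents E) = (\<integral>i. endowment E i \<partial>agents E) $ k" for k
  proof -
    define e where "e = (\<integral>i. endowment E i \<partial>agents E) $ k"
    define F where "F = vimage_algebra (space (completed_prob E)) fst (borel :: 's measure)"
    have fstm: "fst \<in> borel_measurable (completed_prob E)"
      by (rule measurable_joint_completed[OF measurable_fst_joint])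
    interpret F: finite_measure_subalgebra "completed_prob E" F
      by standard (simp add: F_def subalgebra_vimage_algebra[OF fstm])
    have fstF: "fst \<in> measurable F borel"
      unfolding F_def by (rule measurable_vimage_algebra1) simp
    define K where "K s = (\<integral>i. \<xi> i s $ k \<partial>agents E)" for s
    have \<xi>k_meas: "(\<lambda>(s, i). \<xi> i s $ k) \<in> borel_measurable (borel \<Otimes>\<^sub>M agents E)"
    proof -
      have "(\<lambda>(s, i). (i, s, t0)) \<in> measurable (borel \<Otimes>\<^sub>M agents E) G"
        unfolding G_def
        by (rule measurable_vimage_algebra2) (use t0 in \<open>auto simp: space_fubini \<pi>_def split_beta'\<close>)
      from measurable_compose[OF this cG]
      have [measurable]: "(\<lambda>(s, i). c k (i, s, t0)) \<in> borel_measurable (borel \<Otimes>\<^sub>M agents E)"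
        by (simp add: split_beta')
      have "(\<lambda>q. max 0 ((\<lambda>(s, i). c k (i, s, t0)) q)) \<in> borel_measurable (borel \<Otimes>\<^sub>M agents E)"
        by measurable
      then show ?thesis by (simp add: \<xi>_def split_beta')
    qed
    have Km: "K \<in> borel_measurable borel"
      unfolding K_def using \<xi>k_meas by (rule M.borel_measurable_lebesgue_integral)
    have KF: "(\<lambda>\<omega>. K (fst \<omega>)) \<in> borel_measurable F" by (rule measurable_compose[OF fstF Km])
    have ck_\<xi>: "AE p in fubini E. c k p = \<xi> (fst p) (fst (snd p)) $ k"
      using \<xi>_c by eventually_elim simp
    have \<xi>k_int: "integrable (fubini E) (\<lambda>p. \<xi> (fst p) (fst (snd p)) $ k)"
      by (rule integrable_cong_AE_imp[OF c_int Q.measurable_AE_cong[OF borel_measurable_integrable[OF c_int] ck_\<xi>] ck_\<xi>]) simp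
    have K_int: "integrable (completed_prob E) (\<lambda>\<omega>. K (fst \<omega>))"
      using integrable_snd[OF \<xi>k_int] by (simp add: K_def)
    \<comment> \<open>An event of the state, lifted to the product, is measurable for
      \<open>G\<close>; there \<open>\<xi>\<close> may be exchanged for \<open>x\<close> under the
      integral.\<close>
    have eq: "(\<integral>\<omega>\<in>D. e \<partial>completed_prob E) = (\<integral>\<omega>\<in>D. K (fst \<omega>) \<partial>completed_prob E)" if D: "D \<in> sets F" for D
    proof -
      obtain A where A: "A \<in> sets borel" "D = fst -` A \<inter> space (completed_prob E)"
        using D unfolding F_def by (auto simp: sets_vimage_algebra2)
      define g where "g p = indicat_real A (fst (snd p))" for p :: "'i \<times> 's \<times> ('i \<Rightarrow> 'q)"
      have gG: "g \<in> borel_measurable G"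
      proof -
        have "(\<lambda>p. indicat_real A (snd (\<pi> p))) \<in> borel_measurable G"
          using A(1) by (intro measurable_compose[OF measurable_compose[OF \<pi>G measurable_snd]]) simp
        then show ?thesis by (simp add: g_def[abs_def] \<pi>_def)
      qed
      have gQ: "g \<in> borel_measurable (fubini E)" by (rule measurable_from_subalg[OF G.subalg gG])
      have gint: "integrable (fubini E) (\<lambda>p. g p * f p)" if "integrable (fubini E) f" for f
        by (rule Bochner_Integration.integrable_bound[OF that borel_measurable_times[OF gQ borel_measurable_integrable[OF that]]])
           (auto simp: g_def indicator_def)
      have "(\<integral>\<omega>\<in>D. K (fst \<omega>) \<partial>completed_prob E) =
          (\<integral>\<omega>. (\<integral>i. g (i, \<omega>) * \<xi> i (fst \<omega>) $ k \<partial>agents E) \<partial>completed_prob E)"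
        unfolding set_lebesgue_integral_def
        by (rule Bochner_Integration.integral_cong) (auto simp: K_def g_def A(2) indicator_def)
      also have "\<dots> = (\<integral>p. g p * \<xi> (fst p) (fst (snd p)) $ k \<partial>fubini E)"
        using integral_snd[OF gint[OF \<xi>k_int]] by simp
      also have "\<dots> = (\<integral>p. g p * c k p \<partial>fubini E)"
      proof (rule integral_cong_AE)
        show "AE p in fubini E. g p * \<xi> (fst p) (fst (snd p)) $ k = g p * c k p"
          using ck_\<xi> by eventually_elim simp
      qed (use gint[OF \<xi>k_int] gint[OF c_int] in auto)
      also have "\<dots> = (\<integral>p. g p * x (fst p) (snd (snd p)) $ k \<partial>fubini E)"
        unfolding c_def by (rule G.real_cond_exp_intg(2)[OF gint[OF xk_int] gG borel_measurable_integrable[OF xk_int]])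
      also have "\<dots> = (\<integral>\<omega>. (\<integral>i. g (i, \<omega>) * x i (snd \<omega>) $ k \<partial>agents E) \<partial>completed_prob E)"
        using integral_snd[OF gint[OF xk_int]] by simp
      also have "\<dots> = (\<integral>\<omega>\<in>D. e \<partial>completed_prob E)"
        unfolding set_lebesgue_integral_def
      proof (rule integral_cong_AE)
        have "AE \<omega> in completed_prob E. (\<integral>i. x i (snd \<omega>) \<partial>agents E) = (\<integral>i. endowment E i \<partial>agents E)"
          using x by (simp add: feasible_iff)
        with AE_integrable_snd_vec[OF x_int] AE_space
        show "AE \<omega> in completed_prob E. (\<integral>i. g (i, \<omega>) * x i (snd \<omega>) $ k \<partial>agents E) = indicat_real D \<omega> *\<^sub>R e"
        proof eventually_elim
          case (elim \<omega>)
          then have "(\<integral>i. x i (snd \<omega>) $ k \<partial>agents E) = e"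
            using integral_vec_nth[of "agents E" "\<lambda>i. x i (snd \<omega>)" k] by (simp add: e_def)
          with elim show ?case by (simp add: g_def A(2) indicator_def)
        qed
        show "(\<lambda>\<omega>. \<integral>i. g (i, \<omega>) * x i (snd \<omega>) $ k \<partial>agents E) \<in> borel_measurable (completed_prob E)"
          using integrable_snd[OF gint[OF xk_int]] by auto
        have "D \<in> sets (completed_prob E)" using D F.subalg by (auto simp: subalgebra_def)
        then show "(\<lambda>\<omega>. indicat_real D \<omega> *\<^sub>R e) \<in> borel_measurable (completed_prob E)" by measurable
      qed
      finally show ?thesis ..
    qed
    have 1: "AE \<omega> in completed_prob E. real_cond_exp (completed_prob E) F (\<lambda>_. e) \<omega> = K (fst \<omega>)"
      by (rule F.real_cond_exp_charact[OF eq _ K_int KF]) simp_all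
    have 2: "AE \<omega> in completed_prob E. real_cond_exp (completed_prob E) F (\<lambda>_. e) \<omega> = e"
      by (rule F.real_cond_exp_F_meas) simp_all
    from 1 2 y_\<xi>_fst show ?thesis by eventually_elim (simp add: K_def e_def)
  qed
  then have "AE \<omega> in completed_prob E. \<forall>k. (\<integral>i. y i (snd \<omega>) $ k \<partial>agents E) = (\<integral>i. endowment E i \<partial>agents E) $ k"
    by (simp add: AE_all_countable)
  with AE_integrable_snd_vec[OF y_int]
  have "AE \<omega> in completed_prob E. (\<integral>i. y i (snd \<omega>) \<partial>agents E) = (\<integral>i. endowment E i \<partial>agents E)"
    by eventually_elim (simp add: vec_eq_iff integral_vec_nth)
  with y_alloc have y_feas: "feasible E y" by (simp add: feasible_iff)
  define vx where "vx p = state_util p (x (fst p) (snd (snd p)))" for p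
  define vy where "vy p = state_util p (y (fst p) (snd (snd p)))" for p
  have vx: "integrable (fubini E) vx" and vy: "integrable (fubini E) vy"
    unfolding vx_def vy_def by (intro integrable_alloc_util x_alloc y_alloc)+
  have jensen: "AE p in fubini E. real_cond_exp (fubini E) G vx p \<le> vy p"
    unfolding vx_def vy_def
  proof (rule G.real_cond_exp_jensen_orthant[OF _ _ _ x_int])
    show "(\<lambda>p. state_util p z) \<in> borel_measurable G" if "0 \<le> z" for z
      using measurable_compose[OF \<pi>G utility_measurable[OF that]] by (simp add: \<pi>_def state_util_def)
    show "continuous_on {x. 0 \<le> x} (state_util p)" for p
      using utility_continuous by (simp add: state_util_def[abs_def])
    show "concave_on {x. 0 \<le> x} (state_util p)" for p
      using conc by (simp add: state_util_def[abs_def])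
    show "0 \<le> x (fst p) (snd (snd p))" if "p \<in> space (fubini E)" for p
      using that x_nn by (auto simp: space_fubini)
    show "0 \<le> y (fst p) (snd (snd p))" for p by (rule y_nn)
    show "AE p in fubini E. y (fst p) (snd (snd p)) $ k =
        real_cond_exp (fubini E) G (\<lambda>p. x (fst p) (snd (snd p)) $ k) p" for k
      using y_c by eventually_elim (simp add: c_def vec_eq_iff)
    show "integrable (fubini E) (\<lambda>p. state_util p (x (fst p) (snd (snd p))))"
      using vx by (simp add: vx_def[abs_def])
  qed
  \<comment> \<open>\<open>gain\<close> is what an agent would lose by moving from \<open>x\<close>
    to \<open>y\<close>. The conditional expectation lives on the product and gives no statement
    agent by agent, so Jensen's inequality is integrated over the set \<open>A\<close> of losers;
    its indicator depends on the agent alone and is therefore measurable for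
    \<open>G\<close>.\<close>
  define gain where "gain i = ex_ante_utility E i (x i) - ex_ante_utility E i (y i)" for i
  define A where "A = {i. 0 < gain i}"
  have gain: "integrable (agents E) gain"
    unfolding gain_def[abs_def] by (intro Bochner_Integration.integrable_diff integrable_ex_ante_utility x_alloc y_alloc)
  have A: "A \<in> sets (agents E)"
  proof -
    note [measurable] = borel_measurable_integrable[OF gain]
    have "{i \<in> space (agents E). 0 < gain i} \<in> sets (agents E)" by measurable
    then show ?thesis by (simp add: A_def agents_space)
  qed
  have "(\<integral>i. indicat_real A i * gain i \<partial>agents E) \<le> 0"
  proof -
    have gG: "(\<lambda>p. indicat_real A (fst p)) \<in> borel_measurable G"
    proof -
      have "(\<lambda>p. indicat_real A (fst (\<pi> p))) \<in> borel_measurable G"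
        using A by (intro measurable_compose[OF measurable_compose[OF \<pi>G measurable_fst]]) simp
      then show ?thesis by (simp add: \<pi>_def)
    qed
    have int: "integrable (fubini E) (\<lambda>p. indicat_real A (fst p) * f p)" if "integrable (fubini E) f" for f
      by (rule Bochner_Integration.integrable_bound[OF that borel_measurable_times[OF
            measurable_from_subalg[OF G.subalg gG] borel_measurable_integrable[OF that]]])
         (auto simp: indicator_def)
    have rep: "(\<integral>p. indicat_real A (fst p) * f p \<partial>fubini E) =
        (\<integral>i. indicat_real A i * (\<integral>\<omega>. f (i, \<omega>) \<partial>completed_prob E) \<partial>agents E)"
      and rep_int: "integrable (agents E) (\<lambda>i. indicat_real A i * (\<integral>\<omega>. f (i, \<omega>) \<partial>completed_prob E))"
      if "integrable (fubini E) f" for f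
      using integral_fst[OF int[OF that]] integrable_fst[OF int[OF that]] by simp_all
    have "(\<integral>p. indicat_real A (fst p) * vx p \<partial>fubini E) =
        (\<integral>p. indicat_real A (fst p) * real_cond_exp (fubini E) G vx p \<partial>fubini E)"
      by (rule G.real_cond_exp_intg(2)[OF int[OF vx] gG borel_measurable_integrable[OF vx], symmetric])
    also have "\<dots> \<le> (\<integral>p. indicat_real A (fst p) * vy p \<partial>fubini E)"
    proof (rule integral_mono_AE)
      show "AE p in fubini E. indicat_real A (fst p) * real_cond_exp (fubini E) G vx p \<le> indicat_real A (fst p) * vy p"
        using jensen by eventually_elim (auto intro: mult_left_mono)
    qed (intro int vy G.real_cond_exp_int vx)+
    finally have "(\<integral>i. indicat_real A i * ex_ante_utility E i (x i) \<partial>agents E)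
        \<le> (\<integral>i. indicat_real A i * ex_ante_utility E i (y i) \<partial>agents E)"
      unfolding rep[OF vx] rep[OF vy] by (simp add: vx_def vy_def ex_ante_utility_eq)
    then show ?thesis
      using rep_int[OF vx] rep_int[OF vy]
      by (simp add: gain_def right_diff_distrib vx_def vy_def ex_ante_utility_eq)
  qed
  then have "AE i in agents E. 0 = indicat_real A i * gain i"
    using integrable_mult_indicator[OF A gain]
    by (intro integral_eq_imp_AE_eq) (auto simp: A_def indicator_def)
  then have le: "AE i in agents E. ex_ante_utility E i (x i) \<le> ex_ante_utility E i (y i)"
    by eventually_elim (auto simp: A_def gain_def indicator_def split: if_splits)
  show thesis
    using y_feas le by (rule that) (simp add: y_def signal_frequencies_upd)
qed

end


section \<open>Incentive compatibility\<close>

lemma strictly_concave_imp_concave_on: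
  assumes "strictly_concave_on C g"
  shows "concave_on C g"
  unfolding concave_on_iff
proof (intro conjI ballI allI impI)
  show "convex C" using assms by (simp add: strictly_concave_on_def)
  fix x y and u v :: real
  assume *: "x \<in> C" "y \<in> C" "0 \<le> u" "0 \<le> v" "u + v = 1"
  then have u: "u = 1 - v" by simp
  consider "x = y" | "v = 0" | "v = 1" | "x \<noteq> y" "0 < v" "v < 1" using * by force
  then show "u * g x + v * g y \<le> g (u *\<^sub>R x + v *\<^sub>R y)"
  proof cases
    case 1
    then show ?thesis by (simp add: u flip: distrib_right scaleR_left_distrib)
  next
    case 4
    then show ?thesis
      using assms * unfolding strictly_concave_on_def u by (simp add: less_imp_le)
  qed (simp_all add: u)
qed

section \<open>Conditional laws given a signal, and truthful reporting\<close>

context regular_economy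
begin

lemma others_upd_in_space: "r \<in> space (others E i) \<Longrightarrow> r(i := q) \<in> space (profiles E)"
  and restrict_others: "r \<in> space (others E i) \<Longrightarrow> restrict r (- {i}) = r"
proof -
  assume "r \<in> space (others E i)"
  then obtain t where t: "t \<in> space (profiles E)" "r = restrict t (- {i})" by (auto simp: others_space)
  have "r(i := q) = t(i := q)" using t(2) by (auto simp: fun_eq_iff)
  then show "r(i := q) \<in> space (profiles E)" using profile_upd_in_space[OF t(1)] by simp
  show "restrict r (- {i}) = r" using t(2) by simp
qed

lemma measurable_others_upd: "(\<lambda>r. r(i := q)) \<in> measurable (others E i) (profiles E)"
proof (subst measurable_cong_sets[OF refl profiles_sets[of i]], rule measurable_vimage_algebra2)
  show "(\<lambda>r. r(i := q)) \<in> space (others E i) \<rightarrow> space (profiles E)"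
    using others_upd_in_space by blast
  have "(\<lambda>r. (r, q)) \<in> measurable (others E i) (others E i \<Otimes>\<^sub>M count_space UNIV)" by measurable
  then show "(\<lambda>r. (restrict (r(i := q)) (- {i}), (r(i := q)) i)) \<in> measurable (others E i) (others E i \<Otimes>\<^sub>M count_space UNIV)"
    by (subst measurable_cong[where g="\<lambda>r. (r, q)"]) (simp_all add: restrict_others)
qed

lemma measurable_restrict_profile: "(\<lambda>t. restrict t (- {i})) \<in> measurable (profiles E) (others E i)"
  using measurable_compose[OF measurable_split_profile measurable_fst] by simp

text \<open>The conditional law is the image under \<open>\<psi>\<close> of P conditioned on the
  event \<open>B\<close> of signal \<open>q\<close>. Reattaching \<open>q\<close> by
  \<open>\<eta>\<close> undoes \<open>\<psi>\<close> on \<open>B\<close>, so the integral in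
  question is that of \<open>f\<close> over \<open>B\<close>, divided by the probability of
  \<open>B\<close>.\<close>

lemma integrable_cond_prob_others:
  fixes f :: "'s \<times> ('i \<Rightarrow> 'q) \<Rightarrow> real"
  assumes f: "integrable (completed_prob E) f" and q: "0 < measure (signal_distr E i) {q}"
  shows "integrable (completion (cond_prob_others E i q)) (\<lambda>\<omega>. f (fst \<omega>, (snd \<omega>)(i := q)))"
proof -
  interpret J: prob_space "joint E" by (rule joint_prob)
  define B where "B = {\<omega> \<in> space (joint E). signal_proj i \<omega> = q}"
  define \<psi> where "\<psi> \<omega> = (fst \<omega>, restrict (snd \<omega>) (- {i}))" for \<omega> :: "'s \<times> ('i \<Rightarrow> 'q)"
  define \<eta> where "\<eta> \<omega> = (fst \<omega>, (snd \<omega>)(i := q))" for \<omega> :: "'s \<times> ('i \<Rightarrow> 'q)"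
  define D where "D = cond_prob_others E i q"
  have D_eq: "D = distr (uniform_measure (joint E) B) (borel \<Otimes>\<^sub>M others E i) \<psi>"
    unfolding D_def cond_prob_others_def B_def \<psi>_def[abs_def] split_beta' ..
  have B_vimage: "B = signal_proj i -` {q} \<inter> space (joint E)" by (auto simp: B_def)
  have B: "B \<in> sets (joint E)"
    unfolding B_vimage by (rule measurable_sets[OF measurable_signal_proj]) simp
  have B_pos: "0 < measure (joint E) B"
    using q unfolding signal_distr_def B_vimage by (simp add: measure_distr[OF measurable_signal_proj])
  have \<psi>m: "\<psi> \<in> measurable (joint E) (borel \<Otimes>\<^sub>M others E i)"
    unfolding \<psi>_def
    by (intro measurable_Pair measurable_fst_joint measurable_compose[OF measurable_snd_joint measurable_restrict_profile])
  have \<psi>m': "\<psi> \<in> measurable (uniform_measure (joint E) B) (borel \<Otimes>\<^sub>M others E i)"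
    using \<psi>m by simp
  have \<eta>m: "\<eta> \<in> measurable (borel \<Otimes>\<^sub>M others E i) (joint E)"
    unfolding \<eta>_def measurable_cong_sets[OF refl joint_sets]
    by (intro measurable_Pair measurable_fst measurable_compose[OF measurable_snd measurable_others_upd])
  have \<eta>\<psi>: "\<eta> (\<psi> \<omega>) = \<omega>" if "\<omega> \<in> B" for \<omega>
  proof -
    have "snd \<omega> i = q" using that by (simp add: B_def signal_proj_def)
    then have "(restrict (snd \<omega>) (- {i}))(i := q) = snd \<omega>" by (auto simp: fun_eq_iff)
    then show ?thesis by (simp add: \<eta>_def \<psi>_def)
  qed
  \<comment> \<open>\<open>f\<close> is measurable only for the completion, while images and
    densities are handled on the uncompleted space; hence a version \<open>g\<close>, exchanged back
    at the end.\<close>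
  obtain g where g: "g \<in> borel_measurable (joint E)" "AE \<omega> in joint E. f \<omega> = g \<omega>"
    using completion_ex_borel_measurable_real[OF borel_measurable_integrable[OF f[unfolded completed_prob_def]]] by blast
  have "AE \<omega> in completed_prob E. f \<omega> = g \<omega>" using g(2) by (simp add: AE_completed_prob_iff)
  then have "integrable (completed_prob E) g"
    using f measurable_joint_completed[OF g(1)] by (intro integrable_cong_AE_imp[OF f])
  then have g_int: "integrable (joint E) g"
    unfolding completed_prob_def using integrable_completion[OF g(1)] by blast
  have gD_meas: "(\<lambda>\<omega>. g (\<eta> \<omega>)) \<in> borel_measurable (borel \<Otimes>\<^sub>M others E i)"
    by (rule measurable_compose[OF \<eta>m g(1)])
  have "indicator B \<omega> / ennreal (measure (joint E) B) = ennreal (indicat_real B \<omega> / measure (joint E) B)" for \<omega>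
    using divide_ennreal[of 1 "measure (joint E) B"] B_pos by (cases "\<omega> \<in> B") simp_all
  then have unif: "uniform_measure (joint E) B = density (joint E) (\<lambda>\<omega>. ennreal (indicat_real B \<omega> / measure (joint E) B))"
    unfolding uniform_measure_def J.emeasure_eq_measure by simp
  have "integrable (joint E) (\<lambda>\<omega>. (1 / measure (joint E) B) * (indicat_real B \<omega> * g \<omega>))"
    using integrable_mult_indicator[OF B g_int] by simp
  also have "(\<lambda>\<omega>. (1 / measure (joint E) B) * (indicat_real B \<omega> * g \<omega>)) =
      (\<lambda>\<omega>. (indicat_real B \<omega> / measure (joint E) B) *\<^sub>R g (\<eta> (\<psi> \<omega>)))"
    using \<eta>\<psi> by (auto simp: indicator_def)
  finally have "integrable (uniform_measure (joint E) B) (\<lambda>\<omega>. g (\<eta> (\<psi> \<omega>)))"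
    unfolding unif using B measurable_compose[OF \<psi>m gD_meas] by (subst integrable_density) auto
  then have gD: "integrable D (\<lambda>\<omega>. g (\<eta> \<omega>))"
    unfolding D_eq by (subst integrable_distr_eq[OF \<psi>m' gD_meas])
  have "AE \<omega> in D. g (\<eta> \<omega>) = f (\<eta> \<omega>)"
  proof -
    obtain N where N: "{\<omega> \<in> space (joint E). f \<omega> \<noteq> g \<omega>} \<subseteq> N" "N \<in> sets (joint E)" "emeasure (joint E) N = 0"
      by (rule AE_E[OF g(2)]) auto
    \<comment> \<open>The exceptional set is pulled back through \<open>\<eta>\<close>; within
      \<open>B\<close> its preimage under \<open>\<psi>\<close> lies in \<open>N\<close>, so the
      conditional law gives it mass 0.\<close>
    define N' where "N' = \<eta> -` N \<inter> space (borel \<Otimes>\<^sub>M others E i)"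
    have N': "N' \<in> sets (borel \<Otimes>\<^sub>M others E i)"
      unfolding N'_def by (rule measurable_sets[OF \<eta>m N(2)])
    have "B \<inter> (\<psi> -` N' \<inter> space (joint E)) \<subseteq> N"
    proof
      fix \<omega> assume "\<omega> \<in> B \<inter> (\<psi> -` N' \<inter> space (joint E))"
      then have "\<omega> \<in> B" "\<eta> (\<psi> \<omega>) \<in> N" unfolding N'_def by blast+
      then show "\<omega> \<in> N" by (simp add: \<eta>\<psi>)
    qed
    then have "emeasure (joint E) (B \<inter> (\<psi> -` N' \<inter> space (joint E))) \<le> 0"
      using N(2,3) by (metis emeasure_mono)
    then have "emeasure D N' = 0"
      using N' B measurable_sets[OF \<psi>m N']
      by (simp add: D_eq emeasure_distr[OF \<psi>m'] emeasure_uniform_measure)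
    then have "N' \<in> null_sets D" using N' by (simp add: null_sets_def D_eq)
    then show ?thesis
    proof (rule AE_I'[of N'])
      show "{\<omega> \<in> space D. \<not> g (\<eta> \<omega>) = f (\<eta> \<omega>)} \<subseteq> N'"
        using N(1) measurable_space[OF \<eta>m] unfolding N'_def D_eq space_distr by fastforce
    qed
  qed
  then have eq: "AE \<omega> in completion D. g (\<eta> \<omega>) = f (\<eta> \<omega>)" by (rule AE_completion)
  have gD_meas': "(\<lambda>\<omega>. g (\<eta> \<omega>)) \<in> borel_measurable D" using gD_meas by (simp add: D_eq)
  have cD: "integrable (completion D) (\<lambda>\<omega>. g (\<eta> \<omega>))"
    using gD integrable_completion[OF gD_meas'] by blast
  have "integrable (completion D) (\<lambda>\<omega>. f (\<eta> \<omega>))"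
    by (rule integrable_cong_AE_imp[OF cD completion.measurable_AE_cong[OF measurable_completion[OF gD_meas'] eq] eq]) simp
  then show ?thesis by (simp add: D_def \<eta>_def)
qed

text \<open>Truthful and false reports give the same integrand at every point, so both interim
  utilities coincide. Their existence reduces to that of the truthful one, which ex ante
  integrability provides for almost every agent.\<close>

lemma report_invariant_incentive_compatible:
  assumes y: "allocation E y"
    and inv: "\<And>i t q. t \<in> space (profiles E) \<Longrightarrow> y i (t(i := q)) = y i t"
  shows "incentive_compatible E y"
  unfolding incentive_compatible_def
  using AE_integrable_alloc_util[OF y]
proof eventually_elim
  case (elim i)
  show ?case
  proof (intro allI impI)
    fix q q' assume "0 < measure (signal_distr E i) {q} \<and> 0 < measure (signal_distr E i) {q'}"
    then have "integrable (completion (cond_prob_others E i q))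
        (\<lambda>\<omega>. state_util (i, fst \<omega>, (snd \<omega>)(i := q)) (y i (snd (fst \<omega>, (snd \<omega>)(i := q)))))"
      by (intro integrable_cond_prob_others[OF elim]) simp
    then have int: "integrable (completion (cond_prob_others E i q)) (reported_utility_integrand E y i q)"
      by (simp add: reported_utility_integrand_def state_util_def split_beta')
    have eq: "reported_utility_integrand E y i q \<omega> = reported_utility_integrand E y i q' \<omega>"
      if "\<omega> \<in> space (completion (cond_prob_others E i q))" for \<omega>
    proof -
      have "snd \<omega> \<in> space (others E i)"
        using that by (auto simp: cond_prob_others_def space_pair_measure)
      from others_upd_in_space[OF this, of q] inv[of "(snd \<omega>)(i := q)" i q']
      show ?thesis by (simp add: reported_utility_integrand_def split_beta')
    qed
    have "integrable (completion (cond_prob_others E i q)) (reported_utility_integrand E y i q) \<longleftrightarrow>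
        integrable (completion (cond_prob_others E i q)) (reported_utility_integrand E y i q')"
      "interim_utility E y i q q = interim_utility E y i q' q"
      unfolding interim_utility_def
      by (rule Bochner_Integration.integrable_cong[OF refl] Bochner_Integration.integral_cong[OF refl], erule eq)+
    with int show "integrable (completion (cond_prob_others E i q)) (reported_utility_integrand E y i q) \<and>
        integrable (completion (cond_prob_others E i q)) (reported_utility_integrand E y i q') \<and>
        interim_utility E y i q' q \<le> interim_utility E y i q q"
      by simp
  qed
qed

lemma incentive_compatible_efficient_improvement:
  assumes x: "ex_ante_efficient E x" and conc: "\<And>i s. concave_on {x. 0 \<le> x} (\<lambda>x. utility E i x s)"
  obtains y where "incentive_compatible E y" "ex_ante_efficient E y" "utility_equivalent E x y"
proof -
  have "feasible E x" using x by (simp add: ex_ante_efficient_def)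
  then obtain y where y: "feasible E y"
    "AE i in agents E. ex_ante_utility E i (x i) \<le> ex_ante_utility E i (y i)"
    "\<And>i t q. t \<in> space (profiles E) \<Longrightarrow> y i (t(i := q)) = y i t"
    using conc by (rule frequency_based_improvement) blast
  have eq: "AE i in agents E. ex_ante_utility E i (x i) = ex_ante_utility E i (y i)"
    by (rule weak_pareto[OF x y(1,2)])
  show thesis
  proof (rule that)
    show "incentive_compatible E y"
      using y(1,3) by (intro report_invariant_incentive_compatible) (simp_all add: feasible_def)
    show "utility_equivalent E x y" using eq by (simp add: utility_equivalent_def)
    show "ex_ante_efficient E y"
      unfolding ex_ante_efficient_def
    proof (intro conjI notI y(1))
      assume "\<exists>z. feasible E z \<and> (AE i in agents E. ex_ante_utility E i (y i) < ex_ante_utility E i (z i))"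
      then obtain z where z: "feasible E z"
        "AE i in agents E. ex_ante_utility E i (y i) < ex_ante_utility E i (z i)" by blast
      from z(2) eq have "AE i in agents E. ex_ante_utility E i (x i) < ex_ante_utility E i (z i)"
        by eventually_elim simp
      with x z(1) show False by (auto simp: ex_ante_efficient_def)
    qed
  qed
qed

text \<open>Otherwise the midpoint of both allocations would be a strict improvement.\<close>

lemma efficient_utility_equivalent_imp_essentially_equivalent:
  assumes sc: "\<And>i s. strictly_concave_on {x. 0 \<le> x} (\<lambda>x. utility E i x s)"
    and x: "ex_ante_efficient E x" and y: "feasible E y" and xy: "utility_equivalent E x y"
  shows "essentially_equivalent E x y"
proof -
  have x_feas: "feasible E x" using x by (simp add: ex_ante_efficient_def)
  have x_alloc: "allocation E x" and y_alloc: "allocation E y" using x_feas y by (simp_all add: feasible_def)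
  have x_nn: "\<And>i t. t \<in> space (profiles E) \<Longrightarrow> 0 \<le> x i t" and y_nn: "\<And>i t. t \<in> space (profiles E) \<Longrightarrow> 0 \<le> y i t"
    and x_int: "integrable (fubini E) (\<lambda>p. x (fst p) (snd (snd p)))"
    and y_int: "integrable (fubini E) (\<lambda>p. y (fst p) (snd (snd p)))"
    using x_alloc y_alloc by (auto simp: allocation_iff)
  define z where "z i t = (1 / 2) *\<^sub>R x i t + (1 / 2) *\<^sub>R y i t" for i t
  have z_alloc: "allocation E z"
    unfolding allocation_iff using x_nn y_nn x_int y_int
    by (auto simp: z_def intro!: add_nonneg_nonneg scaleR_nonneg_nonneg)
  have "AE \<omega> in completed_prob E. (\<integral>i. z i (snd \<omega>) \<partial>agents E) = (\<integral>i. endowment E i \<partial>agents E)"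
    using x_feas[unfolded feasible_iff, THEN conjunct2] y[unfolded feasible_iff, THEN conjunct2]
      AE_integrable_snd_vec[OF x_int] AE_integrable_snd_vec[OF y_int]
    by eventually_elim (simp add: z_def flip: scaleR_left_distrib)
  with z_alloc have z_feas: "feasible E z" by (simp add: feasible_iff)
  have avg: "state_util p ((1 / 2) *\<^sub>R a + (1 / 2) *\<^sub>R b) \<ge> 1 / 2 * state_util p a + 1 / 2 * state_util p b"
    and avg_strict: "a \<noteq> b \<Longrightarrow> state_util p ((1 / 2) *\<^sub>R a + (1 / 2) *\<^sub>R b) > 1 / 2 * state_util p a + 1 / 2 * state_util p b"
    if ab: "0 \<le> a" "0 \<le> b" for p a b
  proof -
    show *: "state_util p ((1 / 2) *\<^sub>R a + (1 / 2) *\<^sub>R b) > 1 / 2 * state_util p a + 1 / 2 * state_util p b"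
      if "a \<noteq> b"
    proof -
      have "\<forall>a\<ge>0. \<forall>b\<ge>0. \<forall>\<theta>. a \<noteq> b \<and> 0 < \<theta> \<and> \<theta> < 1 \<longrightarrow>
          (1 - \<theta>) * utility E (fst p) a (fst (snd p)) + \<theta> * utility E (fst p) b (fst (snd p)) <
          utility E (fst p) ((1 - \<theta>) *\<^sub>R a + \<theta> *\<^sub>R b) (fst (snd p))"
        using sc[of "fst p" "fst (snd p)"] by (simp add: strictly_concave_on_def)
      from this[rule_format, of a b "1 / 2"] ab that
      have "(1 - 1 / 2) * utility E (fst p) a (fst (snd p)) + 1 / 2 * utility E (fst p) b (fst (snd p)) <
          utility E (fst p) ((1 - 1 / 2) *\<^sub>R a + (1 / 2) *\<^sub>R b) (fst (snd p))" by simp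
      then show ?thesis by (simp add: state_util_def)
    qed
    show "state_util p ((1 / 2) *\<^sub>R a + (1 / 2) *\<^sub>R b) \<ge> 1 / 2 * state_util p a + 1 / 2 * state_util p b"
      using * by (cases "a = b") (auto simp flip: scaleR_left_distrib)
  qed
  have avg_AE: "AE \<omega> in completed_prob E. 1 / 2 * state_util (i, \<omega>) (x i (snd \<omega>)) + 1 / 2 * state_util (i, \<omega>) (y i (snd \<omega>))
      \<le> state_util (i, \<omega>) (z i (snd \<omega>))" for i
    unfolding z_def using x_nn y_nn by (intro AE_I2 avg) (auto simp: space_P)
  have eqxy: "AE i in agents E. ex_ante_utility E i (x i) = ex_ante_utility E i (y i)"
    using xy by (simp add: utility_equivalent_def)
  have avg_int: "AE i in agents E. integrable (completed_prob E)
        (\<lambda>\<omega>. 1 / 2 * state_util (i, \<omega>) (x i (snd \<omega>)) + 1 / 2 * state_util (i, \<omega>) (y i (snd \<omega>))) \<and>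
      (\<integral>\<omega>. 1 / 2 * state_util (i, \<omega>) (x i (snd \<omega>)) + 1 / 2 * state_util (i, \<omega>) (y i (snd \<omega>)) \<partial>completed_prob E)
       = ex_ante_utility E i (x i)"
    using eqxy AE_integrable_alloc_util[OF x_alloc] AE_integrable_alloc_util[OF y_alloc]
    by eventually_elim (simp add: ex_ante_utility_eq)
  have "AE i in agents E. ex_ante_utility E i (x i) \<le> ex_ante_utility E i (z i)"
    using avg_int AE_integrable_alloc_util[OF z_alloc]
  proof eventually_elim
    case (elim i)
    with integral_mono_AE[OF _ elim(2) avg_AE] show ?case by (simp add: ex_ante_utility_eq)
  qed
  \<comment> \<open>The midpoint is feasible and weakly better than \<open>x\<close>, so
    \<open>weak_pareto\<close> leaves no gain. The concavity inequality is then an equality almost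
    surely, which strictness excludes wherever the bundles differ.\<close>
  then have "AE i in agents E. ex_ante_utility E i (x i) = ex_ante_utility E i (z i)"
    by (rule weak_pareto[OF x z_feas])
  with avg_int AE_integrable_alloc_util[OF z_alloc]
  have "AE i in agents E. AE \<omega> in completed_prob E. x i (snd \<omega>) = y i (snd \<omega>)"
  proof eventually_elim
    case (elim i)
    have "AE \<omega> in completed_prob E. 1 / 2 * state_util (i, \<omega>) (x i (snd \<omega>)) + 1 / 2 * state_util (i, \<omega>) (y i (snd \<omega>))
      = state_util (i, \<omega>) (z i (snd \<omega>))"
      using elim by (intro integral_eq_imp_AE_eq avg_AE) (auto simp: ex_ante_utility_eq)
    with AE_space show ?case
    proof eventually_elim
      case (elim \<omega>)
      then have "snd \<omega> \<in> space (profiles E)" by (auto simp: space_P)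
      with avg_strict[OF x_nn y_nn] elim(2) show ?case unfolding z_def by (metis less_irrefl)
    qed
  qed
  then show ?thesis by (simp add: essentially_equivalent_def AE_prob_T_iff)
qed

end

theorem theorem4:
  fixes E :: "('i, 's::polish_space, 'q::finite, 'm::finite) economy"
  assumes "private_information_economy E"
  shows "(assumption_A1 E \<and> assumption_A2 E \<and> assumption_A3 E \<longrightarrow>
            (\<forall>x. ex_ante_efficient E x \<longrightarrow>
              (\<exists>y. incentive_compatible E y \<and> ex_ante_efficient E y \<and>
                   utility_equivalent E x y))) \<and>
         (assumption_A1 E \<and> assumption_A2' E \<and> assumption_A3 E \<longrightarrow>
            (\<forall>x. ex_ante_efficient E x \<longrightarrow>
              (\<exists>y. incentive_compatible E y \<and> ex_ante_efficient E y \<and>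
                   essentially_equivalent E x y)))"
proof (intro conjI impI allI; elim conjE)
  fix x assume "assumption_A1 E" and A2: "assumption_A2 E" and x: "ex_ante_efficient E x"
  then interpret regular_economy E
    using assms by (intro regular_economy.intro regular_economy_axioms.intro)
  have "concave_on {x. 0 \<le> x} (\<lambda>x. utility E i x s)" for i s
    using A2 by (simp add: assumption_A2_def)
  with x obtain y where "incentive_compatible E y" "ex_ante_efficient E y" "utility_equivalent E x y"
    by (rule incentive_compatible_efficient_improvement)
  then show "\<exists>y. incentive_compatible E y \<and> ex_ante_efficient E y \<and> utility_equivalent E x y" by blast
next
  fix x assume "assumption_A1 E" and A2: "assumption_A2' E" and x: "ex_ante_efficient E x"
  then interpret regular_economy E
    using assms by (intro regular_economy.intro regular_economy_axioms.intro)
  have sc: "strictly_concave_on {x. 0 \<le> x} (\<lambda>x. utility E i x s)" for i s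
    using A2 by (simp add: assumption_A2'_def)
  from x strictly_concave_imp_concave_on[OF sc]
  obtain y where y: "incentive_compatible E y" "ex_ante_efficient E y" "utility_equivalent E x y"
    by (rule incentive_compatible_efficient_improvement)
  then have "essentially_equivalent E x y"
    using sc x by (intro efficient_utility_equivalent_imp_essentially_equivalent) (simp_all add: ex_ante_efficient_def)
  with y show "\<exists>y. incentive_compatible E y \<and> ex_ante_efficient E y \<and> essentially_equivalent E x y" by blast
qed

end
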